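(* Let $d\ge1$, $K>0$, and let $\mathbb{P}$ be a $K$-subgaussian distribution on $\mathbb{R}^d$. Then for every $\sigma>0$, $$\mathbb{E}\left[D_{KL}\big(\mathbb{P}_n*\mathcal{N}(0,\sigma^2I_d)\,\big\|\,\mathbb{P}*\mathcal{N}(0,\sigma^2I_d)\big)\right]=\mathcal{O}\left(\frac{(\log n)^d}{n}\right)\qquad(n\to\infty).$$
   Context: A probability distribution $\mathbb{P}$ on $\mathbb{R}^d$ is $K$-subgaussian if, for $X\sim\mathbb{P}$, $\mathbb{E}[e^{\langle\lambda, X-\mathbb{E}[X]\rangle}]\le e^{\frac12K^2\|\lambda\|^2}$ for all $\lambda\in\mathbb{R}^d$. $\mathbb{P}_n=\frac1n\sum_{i=1}^n\delta_{X_i}$ is the empirical measure of i.i.d. samples $X_1,\dots,X_n\sim\mathbb{P}$; the outer expectation is over these samples. $*$ is convolution of measures. $D_{KL}(\mu\|\nu)=\int f\log f\,d\nu$ with $f=\frac{d\mu}{d\nu}$ when $\mu\ll\nu$. The implied constant does not depend on $n$. *)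

theory Defs
  imports "HOL-Probability.Probability" "HOL-Library.Landau_Symbols"
begin

definition mean :: "'a::euclidean_space measure \<Rightarrow> 'a"
  where "mean P = (\<integral>x. x \<partial>P)"

(* The integrability conditions are part of the definition because the Bochner integral of a
   non-integrable function is 0: an infinite moment generating function must not satisfy the bound. *)
definition subgaussian :: "real \<Rightarrow> 'a::euclidean_space measure \<Rightarrow> bool"
  where "subgaussian K P \<longleftrightarrow>
    integrable P (\<lambda>x. x) \<and>
    (\<forall>l. integrable P (\<lambda>x. exp (l \<bullet> (x - mean P))) \<and>
         (\<integral>x. exp (l \<bullet> (x - mean P)) \<partial>P) \<le> exp (K\<^sup>2 * (norm l)\<^sup>2 / 2))"

definition gaussian :: "real \<Rightarrow> 'a::euclidean_space measure"
  where "gaussian \<sigma> = density lborel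
    (\<lambda>x. ennreal (exp (- (norm x)\<^sup>2 / (2 * \<sigma>\<^sup>2)) / (sqrt (2 * pi * \<sigma>\<^sup>2)) ^ DIM('a)))"

definition empirical_measure :: "nat \<Rightarrow> (nat \<Rightarrow> 'a::topological_space) \<Rightarrow> 'a measure"
  where "empirical_measure n x = measure_of UNIV (sets borel)
    (\<lambda>A. (\<Sum>i<n. emeasure (return borel (x i)) A) / of_nat n)"

lemma
  shows space_empirical_measure [simp]: "space (empirical_measure n x) = UNIV"
    and sets_empirical_measure [simp]: "sets (empirical_measure n x) = sets borel"
  unfolding empirical_measure_def
  using sets.sigma_sets_eq[of borel] by (simp_all add: space_measure_of_conv)

(* The set function in the definition is countably additive, so measure_of returns it unchanged. *)
lemma emeasure_empirical_measure:
  assumes "A \<in> sets borel"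
  shows "emeasure (empirical_measure n x) A
           = (\<Sum>i<n. emeasure (return borel (x i)) A) / of_nat n"
proof (rule emeasure_measure_of[OF empirical_measure_def])
  show "countably_additive (sets (empirical_measure n x))
      (\<lambda>A. (\<Sum>i<n. emeasure (return borel (x i)) A) / of_nat n)"
  proof (rule countably_additiveI)
    fix B :: "nat \<Rightarrow> 'a set"
    assume B: "range B \<subseteq> sets (empirical_measure n x)" "disjoint_family B"
    have "(\<Sum>k. (\<Sum>i<n. emeasure (return borel (x i)) (B k)) / of_nat n)
        = (\<Sum>k. \<Sum>i<n. emeasure (return borel (x i)) (B k)) / of_nat n"
      by simp
    also have "(\<Sum>k. \<Sum>i<n. emeasure (return borel (x i)) (B k))
        = (\<Sum>i<n. \<Sum>k. emeasure (return borel (x i)) (B k))"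
      by (rule suminf_sum) simp
    also have "\<dots> = (\<Sum>i<n. emeasure (return borel (x i)) (\<Union>k. B k))"
      using B by (intro sum.cong refl suminf_emeasure) simp_all
    finally show "(\<Sum>k. (\<Sum>i<n. emeasure (return borel (x i)) (B k)) / of_nat n)
        = (\<Sum>i<n. emeasure (return borel (x i)) (\<Union>k. B k)) / of_nat n" .
  qed
qed (use assms in \<open>auto simp: positive_def\<close>)

(* The library's KL_divergence takes the base of the logarithm first and the reference measure
   second. Its value is the integral of ln f with respect to \<mu>, where f = d\<mu>/d\<nu>, which is
   the integral of f * ln f with respect to \<nu>. *)
definition D_KL :: "'a measure \<Rightarrow> 'a measure \<Rightarrow> real"
  where "D_KL \<mu> \<nu> = KL_divergence (exp 1) \<nu> \<mu>"

(* KL_divergence is real-valued and carries no information when \<mu> is not absolutely continuous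
   with respect to \<nu> or when the integral diverges. This predicate excludes both cases. *)
definition finite_D_KL :: "'a measure \<Rightarrow> 'a measure \<Rightarrow> bool"
  where "finite_D_KL \<mu> \<nu> \<longleftrightarrow>
    absolutely_continuous \<nu> \<mu> \<and> integrable \<mu> (entropy_density (exp 1) \<nu> \<mu>)"

end

theory Submission
  imports Defs
begin

text \<open>
  Let \<open>\<phi>\<close> be the Gaussian density, \<open>p\<close> the density of \<open>P \<star> gaussian \<sigma>\<close>, and \<open>q\<close> the density of the smoothed
  empirical measure, so that \<open>q y\<close> is the mean of the independent variables \<open>\<phi> (y - X i)\<close>, each of expectation
  \<open>p y\<close>. The divergence is the integral over \<open>y\<close> of \<open>q y * ln (q y / p y)\<close>. For fixed \<open>y\<close>, a conditional form of
  Jensen's inequality (\<open>expectation_mean_ln_mean_le\<close>) bounds the expectation of this integrand by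
  \<open>G y\<close>, the mean of \<open>\<phi> (y - x) * ln (1 + \<phi> (y - x) / (n * p y))\<close> over \<open>x\<close> distributed according to \<open>P\<close>.

  Two estimates of \<open>G\<close> are available. From \<open>ln (1 + t) \<le> t\<close> one gets \<open>G y \<le> \<phi> 0 / n\<close> for every \<open>y\<close>
  (\<open>kl_bound_integrand_le_peak\<close>). On the other hand \<open>p\<close> cannot decay faster than a Gaussian
  (\<open>smooth_pdf_lower_bound\<close>), so the logarithm is at most of order \<open>exp (norm y)\<close> and \<open>G y\<close> is at most of order
  \<open>exp (norm y) * p y\<close> (\<open>kl_bound_integrand_le_smooth_pdf\<close>). A subgaussian distribution, smoothed by a
  Gaussian, integrates \<open>exp (2 * norm y)\<close>, so the part of the latter outside a cube of half side \<open>R\<close> is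
  of order \<open>exp (- R)\<close>. The first estimate inside the cube with \<open>R = ln n\<close> and the second one outside give
  \<open>\<phi> 0 * (2 * ln n) ^ d / n\<close> plus a term of order \<open>1 / n\<close>. The logarithm
  in \<open>G\<close> is what keeps it integrable for \<open>K\<close> above \<open>\<sigma>\<close>, where the chi-square divergence can be infinite.
\<close>

section \<open>Elementary inequalities for the logarithm\<close>

lemma ln_le_tangent:
  assumes "t > 0" "a > (0::real)"
  shows "ln t \<le> ln a + t / a - 1"
proof -
  have "ln (t / a) \<le> t / a - 1"
    using assms by (intro ln_le_minus_one) simp
  then show ?thesis using assms by (simp add: ln_div)
qed

lemma mult_ln_divide_minus_nonneg:
  assumes "t > 0" "s > (0::real)"
  shows "t * ln (t / s) - t + s \<ge> 0"
proof -
  have "1 - s / t \<le> ln (t / s)"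
    using ln_le_minus_one[of "s / t"] assms by (simp add: ln_div)
  then have "t * (1 - s / t) \<le> t * ln (t / s)"
    using assms by (intro mult_left_mono) auto
  then show ?thesis using assms by (simp add: algebra_simps)
qed

section \<open>The Gaussian distribution\<close>

definition gauss_pdf :: "real \<Rightarrow> 'a::euclidean_space \<Rightarrow> real"
  where "gauss_pdf \<sigma> x = exp (- (norm x)\<^sup>2 / (2 * \<sigma>\<^sup>2)) / (sqrt (2 * pi * \<sigma>\<^sup>2)) ^ DIM('a)"

lemma gaussian_eq_density: "gaussian \<sigma> = density lborel (\<lambda>x. ennreal (gauss_pdf \<sigma> x))"
  by (simp add: gaussian_def gauss_pdf_def)

lemma gauss_pdf_measurable [measurable]: "gauss_pdf \<sigma> \<in> borel_measurable borel"
  unfolding gauss_pdf_def[abs_def] by measurable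

lemma gauss_pdf_pos: "\<sigma> > 0 \<Longrightarrow> gauss_pdf \<sigma> x > 0"
  by (simp add: gauss_pdf_def)

lemma gauss_pdf_le_peak:
  "\<sigma> > 0 \<Longrightarrow> gauss_pdf \<sigma> (x :: 'a::euclidean_space) \<le> gauss_pdf \<sigma> (0::'a)"
  by (simp add: gauss_pdf_def divide_right_mono)

lemma gauss_pdf_eq_peak_mult:
  "gauss_pdf \<sigma> (x :: 'a::euclidean_space) = gauss_pdf \<sigma> (0::'a) * exp (- (norm x)\<^sup>2 / (2 * \<sigma>\<^sup>2))"
  by (simp add: gauss_pdf_def)

lemma gauss_pdf_eq_prod_normal_density:
  assumes "\<sigma> > 0"
  shows "gauss_pdf \<sigma> (x :: 'a::euclidean_space) = (\<Prod>b\<in>Basis. normal_density 0 \<sigma> (x \<bullet> b))"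
proof -
  have "(norm x)\<^sup>2 = (\<Sum>b\<in>Basis. (x \<bullet> b)\<^sup>2)"
    unfolding power2_norm_eq_inner by (subst euclidean_inner) (simp add: power2_eq_square)
  then have "exp (- (norm x)\<^sup>2 / (2 * \<sigma>\<^sup>2)) = (\<Prod>b\<in>Basis. exp (- (x \<bullet> b)\<^sup>2 / (2 * \<sigma>\<^sup>2)))"
    by (simp add: exp_sum[symmetric] sum_negf sum_divide_distrib)
  then show ?thesis
    by (simp add: gauss_pdf_def normal_density_def prod.distrib power_one_over prod_dividef)
qed

lemma nn_integral_gauss_pdf:
  assumes "\<sigma> > 0"
  shows "(\<integral>\<^sup>+x. gauss_pdf \<sigma> (x :: 'a::euclidean_space) \<partial>lborel) = 1"
proof -
  have one: "(\<integral>\<^sup>+t. ennreal (normal_density 0 \<sigma> t) \<partial>lborel) = 1"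
    using assms by (subst nn_integral_eq_integral) (auto simp: integral_normal_density)
  have "(\<integral>\<^sup>+x. gauss_pdf \<sigma> (x :: 'a) \<partial>lborel)
      = (\<integral>\<^sup>+x. (\<Prod>b\<in>Basis. ennreal (normal_density 0 \<sigma> (x \<bullet> b))) \<partial>(lborel :: 'a measure))"
    by (simp add: gauss_pdf_eq_prod_normal_density[OF assms] prod_ennreal)
  also have "\<dots> = (\<Prod>b\<in>(Basis :: 'a set). \<integral>\<^sup>+t. ennreal (normal_density 0 \<sigma> t) \<partial>lborel)"
    by (rule nn_integral_lborel_prod) auto
  also have "\<dots> = 1"
    unfolding one by (rule prod.neutral_const)
  finally show ?thesis .
qed

lemma sets_gaussian [simp, measurable_cong]: "sets (gaussian \<sigma>) = sets borel"
  by (simp add: gaussian_eq_density)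

lemma prob_space_gaussian:
  assumes "\<sigma> > 0"
  shows "prob_space (gaussian \<sigma> :: 'a::euclidean_space measure)"
proof
  show "emeasure (gaussian \<sigma> :: 'a measure) (space (gaussian \<sigma>)) = 1"
    by (simp add: gaussian_eq_density emeasure_density nn_integral_gauss_pdf[OF assms])
qed

text \<open>
  Completing the square in the exponent shows that the factor \<open>exp (2 * norm z)\<close> costs no more than
  doubling the standard deviation, so the integral is a multiple of the total mass of a wider Gaussian.
\<close>

lemma gaussian_exp_norm_finite:
  assumes "\<sigma> > 0"
  shows "(\<integral>\<^sup>+z. ennreal (exp (2 * norm z)) \<partial>(gaussian \<sigma> :: 'a::euclidean_space measure)) < \<infinity>"
proof -
  define C where "C = exp (8 * \<sigma>\<^sup>2 / 3) * 2 ^ DIM('a)"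
  have le: "gauss_pdf \<sigma> z * exp (2 * norm z) \<le> C * gauss_pdf (2 * \<sigma>) z" for z :: 'a
  proof -
    \<comment> \<open>\<open>3 / (8 \<sigma>\<^sup>2)\<close> is the gap between the rates \<open>1 / (2 \<sigma>\<^sup>2)\<close> and \<open>1 / (2 (2 \<sigma>)\<^sup>2)\<close> of the two Gaussians.\<close>
    have "0 \<le> (3 / (8 * \<sigma>\<^sup>2)) * (norm z - 8 * \<sigma>\<^sup>2 / 3)\<^sup>2" by simp
    also have "\<dots> = 3 * (norm z)\<^sup>2 / (8 * \<sigma>\<^sup>2) - 2 * norm z + 8 * \<sigma>\<^sup>2 / 3"
      using assms by (simp add: power2_diff field_simps power2_eq_square)
    finally have "2 * norm z \<le> 3 * ((norm z)\<^sup>2 / (8 * \<sigma>\<^sup>2)) + 8 * \<sigma>\<^sup>2 / 3"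
      by simp
    moreover have "(norm z)\<^sup>2 / (2 * \<sigma>\<^sup>2) = 4 * ((norm z)\<^sup>2 / (8 * \<sigma>\<^sup>2))"
      by simp
    ultimately have "- (norm z)\<^sup>2 / (2 * \<sigma>\<^sup>2) + 2 * norm z \<le> 8 * \<sigma>\<^sup>2 / 3 - (norm z)\<^sup>2 / (8 * \<sigma>\<^sup>2)"
      by linarith
    then have "exp (- (norm z)\<^sup>2 / (2 * \<sigma>\<^sup>2)) * exp (2 * norm z)
        \<le> exp (8 * \<sigma>\<^sup>2 / 3) * exp (- (norm z)\<^sup>2 / (8 * \<sigma>\<^sup>2))"
      by (simp add: exp_add[symmetric])
    moreover have "2 * pi * (2 * \<sigma>)\<^sup>2 = 2\<^sup>2 * (2 * pi * \<sigma>\<^sup>2)"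
      by (simp add: power2_eq_square)
    then have "sqrt (2 * pi * (2 * \<sigma>)\<^sup>2) = 2 * sqrt (2 * pi * \<sigma>\<^sup>2)"
      by (simp only: real_sqrt_mult real_sqrt_abs abs_numeral)
    ultimately show ?thesis
      using assms
      by (simp add: gauss_pdf_def C_def power_mult_distrib divide_right_mono)
  qed
  have "(\<integral>\<^sup>+z. ennreal (exp (2 * norm z)) \<partial>(gaussian \<sigma> :: 'a measure))
      = (\<integral>\<^sup>+z. ennreal (gauss_pdf \<sigma> z * exp (2 * norm z)) \<partial>(lborel :: 'a measure))"
    using gauss_pdf_pos[OF assms, where 'a='a]
    by (auto simp: gaussian_eq_density nn_integral_density ennreal_mult less_imp_le intro!: nn_integral_cong)
  also have "\<dots> \<le> (\<integral>\<^sup>+z. ennreal C * ennreal (gauss_pdf (2 * \<sigma>) z) \<partial>(lborel :: 'a measure))"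
    using le by (intro nn_integral_mono) (auto simp: ennreal_mult'[symmetric] C_def intro!: ennreal_leI)
  also have "\<dots> = ennreal C"
    using assms by (simp add: nn_integral_cmult nn_integral_gauss_pdf)
  finally show ?thesis by (simp add: le_less_trans)
qed

section \<open>Densities smoothed by a Gaussian\<close>

definition smooth_pdf :: "real \<Rightarrow> 'a::euclidean_space measure \<Rightarrow> 'a \<Rightarrow> real"
  where "smooth_pdf \<sigma> \<mu> y = (\<integral>x. gauss_pdf \<sigma> (y - x) \<partial>\<mu>)"

locale borel_prob = prob_space \<mu> for \<mu> :: "'a::euclidean_space measure" +
  assumes sets_eq [measurable_cong, simp]: "sets \<mu> = sets borel"
begin

lemma space_eq [simp]: "space \<mu> = UNIV"
  using sets_eq_imp_space_eq[OF sets_eq] by simp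

lemma smooth_pdf_measurable [measurable]: "smooth_pdf \<sigma> \<mu> \<in> borel_measurable borel"
  unfolding smooth_pdf_def[abs_def] by measurable

lemma integrable_gauss_pdf:
  assumes "\<sigma> > 0"
  shows "integrable \<mu> (\<lambda>x. gauss_pdf \<sigma> (y - x))"
proof (rule integrable_const_bound[of _ "gauss_pdf \<sigma> (0::'a)"])
  show "AE x in \<mu>. norm (gauss_pdf \<sigma> (y - x)) \<le> gauss_pdf \<sigma> (0::'a)"
    using gauss_pdf_le_peak[OF assms, where 'a='a] gauss_pdf_pos[OF assms, where 'a='a]
    by (simp add: abs_of_pos)
qed simp

lemma smooth_pdf_le_peak:
  assumes "\<sigma> > 0"
  shows "smooth_pdf \<sigma> \<mu> y \<le> gauss_pdf \<sigma> (0::'a)"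
  unfolding smooth_pdf_def
  by (intro integral_le_const integrable_gauss_pdf assms) (simp add: gauss_pdf_le_peak assms)

text \<open>
  Some ball around the origin carries half of the mass of \<open>\<mu>\<close>, and \<open>y\<close> sees all of that mass from a
  distance at most \<open>norm y + M\<close>. Hence the density decays no faster than a Gaussian. The weaker rate
  \<open>L * exp (norm y)\<close> in the exponent, instead of a quadratic one, lets every logarithm of a density ratio
  below be absorbed by an exponential moment.
\<close>

lemma smooth_pdf_lower_bound:
  assumes "\<sigma> > 0"
  obtains L where "L \<ge> 1"
    and "\<And>y. gauss_pdf \<sigma> (0::'a) * exp (- L * exp (norm y)) \<le> smooth_pdf \<sigma> \<mu> y"
proof -
  have "(\<lambda>k::nat. measure \<mu> (cball 0 (real k))) \<longlonglongrightarrow> measure \<mu> (\<Union>k. cball 0 (real k))"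
    by (rule finite_Lim_measure_incseq) (auto intro!: incseq_SucI)
  moreover have "(\<Union>k. cball 0 (real k)) = (UNIV :: 'a set)"
    using real_arch_simple by auto
  ultimately have "(\<lambda>k::nat. measure \<mu> (cball 0 (real k))) \<longlonglongrightarrow> 1"
    using prob_space by simp
  then have "\<forall>\<^sub>F k in sequentially. measure \<mu> (cball 0 (real k)) > 1 / 2"
    by (rule order_tendstoD) simp
  then obtain k :: nat where k: "measure \<mu> (cball 0 (real k)) > 1 / 2"
    by (auto simp: eventually_sequentially)
  \<comment> \<open>In the exponent the mass of the ball costs at most 1, because \<open>exp (- 1) \<le> 1 / 2\<close>, and the quadratic
    term at most \<open>(norm y)\<^sup>2 / \<sigma>\<^sup>2 + M\<^sup>2 / \<sigma>\<^sup>2\<close>; the bound \<open>r\<^sup>2 \<le> 2 * exp r\<close> absorbs both into \<open>L\<close>.\<close>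
  define M where "M = real k"
  define L where "L = 1 + M\<^sup>2 / \<sigma>\<^sup>2 + 2 / \<sigma>\<^sup>2"
  show ?thesis
  proof (rule that[of L])
    show "L \<ge> 1" by (simp add: L_def)
  next
    fix y :: 'a
    define v where "v = gauss_pdf \<sigma> (0::'a) * exp (- (norm y + M)\<^sup>2 / (2 * \<sigma>\<^sup>2))"
    have v0: "v \<ge> 0" using gauss_pdf_pos[OF assms, of "0::'a"] by (simp add: v_def)
    have e1: "1 \<le> exp (norm y)" by simp
    have "1 + norm y + (norm y)\<^sup>2 / 2 \<le> exp (norm y)"
      by (rule exp_lower_Taylor_quadratic) simp
    then have r: "(norm y)\<^sup>2 \<le> 2 * exp (norm y)"
      using norm_ge_zero[of y] by linarith
    have "2 * norm y * M \<le> (norm y)\<^sup>2 + M\<^sup>2"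
      using sum_squares_bound[of "norm y" M] by simp
    then have "(norm y + M)\<^sup>2 \<le> 2 * (norm y)\<^sup>2 + 2 * M\<^sup>2"
      by (simp add: power2_sum)
    then have "(norm y + M)\<^sup>2 / (2 * \<sigma>\<^sup>2) \<le> (2 * (norm y)\<^sup>2 + 2 * M\<^sup>2) / (2 * \<sigma>\<^sup>2)"
      by (intro divide_right_mono) auto
    also have "\<dots> = (norm y)\<^sup>2 / \<sigma>\<^sup>2 + M\<^sup>2 / \<sigma>\<^sup>2 * 1"
      using assms by (simp add: field_simps)
    also have "\<dots> \<le> 2 * exp (norm y) / \<sigma>\<^sup>2 + M\<^sup>2 / \<sigma>\<^sup>2 * exp (norm y)"
      using r e1 by (intro add_mono divide_right_mono mult_left_mono) auto
    finally have "(norm y + M)\<^sup>2 / (2 * \<sigma>\<^sup>2) \<le> 2 * exp (norm y) / \<sigma>\<^sup>2 + M\<^sup>2 / \<sigma>\<^sup>2 * exp (norm y)" .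
    moreover have L_exp: "L * exp (norm y)
        = exp (norm y) + M\<^sup>2 / \<sigma>\<^sup>2 * exp (norm y) + 2 * exp (norm y) / \<sigma>\<^sup>2"
      by (simp add: L_def distrib_right)
    ultimately have q: "1 + (norm y + M)\<^sup>2 / (2 * \<sigma>\<^sup>2) \<le> L * exp (norm y)"
      using e1 L_exp by linarith
    have half: "exp (- 1) \<le> (1 / 2 :: real)"
      using exp_ge_add_one_self[of 1] by (simp add: exp_minus field_simps)
    have "gauss_pdf \<sigma> (0::'a) * exp (- L * exp (norm y))
        \<le> gauss_pdf \<sigma> (0::'a) * exp (- 1 + - (norm y + M)\<^sup>2 / (2 * \<sigma>\<^sup>2))"
      using q gauss_pdf_pos[OF assms, of "0::'a"] by (intro mult_left_mono) auto
    also have "\<dots> = v * exp (- 1)"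
      unfolding v_def exp_add by simp
    also have "\<dots> \<le> v * measure \<mu> (cball 0 M)"
      using k half v0 by (intro mult_left_mono) (auto simp: M_def)
    also have "\<dots> = (\<integral>x. v * indicator (cball 0 M) x \<partial>\<mu>)"
      by simp
    also have "\<dots> \<le> smooth_pdf \<sigma> \<mu> y"
      unfolding smooth_pdf_def
    proof (rule integral_mono)
      show "integrable \<mu> (\<lambda>x. v * indicator (cball 0 M) x)"
        by (intro integrable_mult_right integrable_real_indicator)
           (auto simp: emeasure_eq_measure)
      fix x
      show "v * indicator (cball 0 M) x \<le> gauss_pdf \<sigma> (y - x)"
      proof (cases "x \<in> cball 0 M")
        case True
        then have "norm (y - x) \<le> norm y + M"
          using norm_triangle_ineq4[of y x] by auto
        then have "(norm (y - x))\<^sup>2 \<le> (norm y + M)\<^sup>2"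
          by (intro power_mono) auto
        then have "v \<le> gauss_pdf \<sigma> (y - x)"
          unfolding v_def gauss_pdf_eq_peak_mult[of _ "y - x"]
          using gauss_pdf_pos[OF assms, of "0::'a"]
          by (intro mult_left_mono) (auto simp: divide_right_mono)
        then show ?thesis using True by simp
      qed (simp add: gauss_pdf_pos[OF assms] less_imp_le)
    qed (rule integrable_gauss_pdf[OF assms])
    finally show "gauss_pdf \<sigma> (0::'a) * exp (- L * exp (norm y)) \<le> smooth_pdf \<sigma> \<mu> y" .
  qed
qed

lemma smooth_pdf_pos:
  assumes "\<sigma> > 0"
  shows "smooth_pdf \<sigma> \<mu> y > 0"
proof -
  obtain L where "gauss_pdf \<sigma> (0::'a) * exp (- L * exp (norm y)) \<le> smooth_pdf \<sigma> \<mu> y"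
    using smooth_pdf_lower_bound[OF assms] by metis
  moreover have "0 < gauss_pdf \<sigma> (0::'a) * exp (- L * exp (norm y))"
    using gauss_pdf_pos[OF assms, of "0::'a"] by simp
  ultimately show ?thesis by linarith
qed

end

lemma convolution_gaussian_eq_density:
  fixes \<mu> :: "'a::ordered_euclidean_space measure"
  assumes "prob_space \<mu>" "sets \<mu> = sets borel" "\<sigma> > 0"
  shows "\<mu> \<star> gaussian \<sigma> = density lborel (\<lambda>y. ennreal (smooth_pdf \<sigma> \<mu> y))"
proof (rule measure_eqI)
  interpret borel_prob \<mu> by (simp add: borel_prob_def borel_prob_axioms_def assms)
  interpret G: prob_space "gaussian \<sigma> :: 'a measure" by (rule prob_space_gaussian) fact
  interpret pair_sigma_finite \<mu> "lborel :: 'a measure" ..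
  fix A :: "'a set" assume "A \<in> sets (\<mu> \<star> gaussian \<sigma>)"
  then have [measurable]: "A \<in> sets borel" by simp
  have "emeasure (\<mu> \<star> gaussian \<sigma>) A = (\<integral>\<^sup>+y. indicator A y \<partial>(\<mu> \<star> gaussian \<sigma>))"
    by simp
  also have "\<dots> = (\<integral>\<^sup>+x. \<integral>\<^sup>+z. indicator A (x + z) \<partial>gaussian \<sigma> \<partial>\<mu>)"
    by (rule nn_integral_convolution) (auto intro: finite_measure_axioms G.finite_measure_axioms)
  also have "\<dots> = (\<integral>\<^sup>+x. \<integral>\<^sup>+y. ennreal (gauss_pdf \<sigma> (y - x)) * indicator A y \<partial>lborel \<partial>\<mu>)"
  proof (rule nn_integral_cong)
    fix x :: 'a
    have "(\<integral>\<^sup>+y. ennreal (gauss_pdf \<sigma> (y - x)) * indicator A y \<partial>lborel)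
        = (\<integral>\<^sup>+y. ennreal (gauss_pdf \<sigma> (y - x)) * indicator A y \<partial>distr lborel borel ((+) x))"
      by (simp add: lborel_distr_plus)
    also have "\<dots> = (\<integral>\<^sup>+z. ennreal (gauss_pdf \<sigma> z) * indicator A (x + z) \<partial>lborel)"
      by (subst nn_integral_distr) auto
    also have "\<dots> = (\<integral>\<^sup>+z. indicator A (x + z) \<partial>gaussian \<sigma>)"
      by (simp add: gaussian_eq_density nn_integral_density)
    finally show "(\<integral>\<^sup>+z. indicator A (x + z) \<partial>gaussian \<sigma>)
        = (\<integral>\<^sup>+y. ennreal (gauss_pdf \<sigma> (y - x)) * indicator A y \<partial>lborel)" ..
  qed
  also have "\<dots> = (\<integral>\<^sup>+y. \<integral>\<^sup>+x. ennreal (gauss_pdf \<sigma> (y - x)) * indicator A y \<partial>\<mu> \<partial>lborel)"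
    by (rule Fubini'[symmetric]) measurable
  also have "\<dots> = (\<integral>\<^sup>+y. ennreal (smooth_pdf \<sigma> \<mu> y) * indicator A y \<partial>lborel)"
    using gauss_pdf_pos[OF \<open>\<sigma> > 0\<close>, where 'a='a]
    by (intro nn_integral_cong)
       (simp add: nn_integral_multc smooth_pdf_def nn_integral_eq_integral
          integrable_gauss_pdf \<open>\<sigma> > 0\<close> less_imp_le)
  also have "\<dots> = emeasure (density lborel (\<lambda>y. ennreal (smooth_pdf \<sigma> \<mu> y))) A"
    by (simp add: emeasure_density)
  finally show "emeasure (\<mu> \<star> gaussian \<sigma>) A
      = emeasure (density lborel (\<lambda>y. ennreal (smooth_pdf \<sigma> \<mu> y))) A" .
qed simp

lemma nn_integral_smooth_pdf:
  fixes \<mu> :: "'a::ordered_euclidean_space measure"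
  assumes "prob_space \<mu>" "sets \<mu> = sets borel" "\<sigma> > 0"
  shows "(\<integral>\<^sup>+y. ennreal (smooth_pdf \<sigma> \<mu> y) \<partial>lborel) = 1"
proof -
  interpret borel_prob \<mu> by (simp add: borel_prob_def borel_prob_axioms_def assms)
  interpret G: prob_space "gaussian \<sigma> :: 'a measure" by (rule prob_space_gaussian) fact
  have "(\<integral>\<^sup>+y. ennreal (smooth_pdf \<sigma> \<mu> y) \<partial>lborel) = (\<integral>\<^sup>+y. 1 \<partial>(\<mu> \<star> gaussian \<sigma>))"
    unfolding convolution_gaussian_eq_density[OF assms]
    by (subst nn_integral_density) auto
  also have "\<dots> = 1"
    using emeasure_space_1 G.emeasure_space_1
    by (subst nn_integral_convolution)
       (auto intro: finite_measure_axioms G.finite_measure_axioms)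
  finally show ?thesis .
qed

lemma smooth_pdf_exp_norm_finite:
  fixes \<mu> :: "'a::ordered_euclidean_space measure"
  assumes "prob_space \<mu>" "sets \<mu> = sets borel" "\<sigma> > 0"
    and fin: "(\<integral>\<^sup>+x. ennreal (exp (2 * norm x)) \<partial>\<mu>) < \<infinity>"
  shows "(\<integral>\<^sup>+y. ennreal (smooth_pdf \<sigma> \<mu> y * exp (2 * norm y)) \<partial>lborel) < \<infinity>"
proof -
  interpret borel_prob \<mu> by (simp add: borel_prob_def borel_prob_axioms_def assms)
  interpret G: prob_space "gaussian \<sigma> :: 'a measure" by (rule prob_space_gaussian) fact
  have le: "ennreal (exp (2 * norm (x + z))) \<le> ennreal (exp (2 * norm x)) * ennreal (exp (2 * norm z))"
    for x z :: 'a
  proof -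
    have "exp (2 * norm (x + z)) \<le> exp (2 * norm x) * exp (2 * norm z)"
      using norm_triangle_ineq[of x z] by (simp add: exp_add[symmetric])
    then show ?thesis
      by (simp add: ennreal_mult[symmetric])
  qed
  have "(\<integral>\<^sup>+y. ennreal (smooth_pdf \<sigma> \<mu> y * exp (2 * norm y)) \<partial>lborel)
      = (\<integral>\<^sup>+y. ennreal (exp (2 * norm y)) \<partial>(\<mu> \<star> gaussian \<sigma>))"
    unfolding convolution_gaussian_eq_density[OF assms(1-3)]
    by (subst nn_integral_density)
       (auto simp: ennreal_mult' less_imp_le[OF smooth_pdf_pos[OF \<open>\<sigma> > 0\<close>]])
  also have "\<dots> = (\<integral>\<^sup>+x. \<integral>\<^sup>+z. ennreal (exp (2 * norm (x + z))) \<partial>gaussian \<sigma> \<partial>\<mu>)"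
    by (rule nn_integral_convolution) (auto intro: finite_measure_axioms G.finite_measure_axioms)
  also have "\<dots> \<le> (\<integral>\<^sup>+x. \<integral>\<^sup>+z. ennreal (exp (2 * norm x)) * ennreal (exp (2 * norm z)) \<partial>(gaussian \<sigma> :: 'a measure) \<partial>\<mu>)"
    by (intro nn_integral_mono le)
  also have "\<dots> = (\<integral>\<^sup>+x. ennreal (exp (2 * norm x)) \<partial>\<mu>)
      * (\<integral>\<^sup>+z. ennreal (exp (2 * norm z)) \<partial>(gaussian \<sigma> :: 'a measure))"
    by (simp add: nn_integral_cmult nn_integral_multc)
  also have "\<dots> < \<infinity>"
    using fin gaussian_exp_norm_finite[OF \<open>\<sigma> > 0\<close>, where 'a='a] by (simp add: ennreal_mult_less_top)
  finally show ?thesis .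
qed

section \<open>Exponential moments of the empirical measure and of subgaussian distributions\<close>

text \<open>
  As the law of \<open>x i\<close> for a uniformly chosen index \<open>i\<close>, the empirical measure inherits everything from
  the transport lemmas for image measures and finite uniform distributions.
\<close>

lemma empirical_measure_eq_distr:
  fixes x :: "nat \<Rightarrow> 'a::euclidean_space"
  assumes "n \<ge> 1"
  shows "empirical_measure n x = distr (measure_pmf (pmf_of_set {..<n})) borel x"
proof (rule measure_eqI)
  fix A assume "A \<in> sets (empirical_measure n x)"
  then have A: "A \<in> sets borel" by simp
  have ne: "{..<n} \<noteq> {}" using assms by (simp add: lessThan_empty_iff)
  have "emeasure (distr (measure_pmf (pmf_of_set {..<n})) borel x) A
      = (\<integral>\<^sup>+z. indicator A z \<partial>distr (measure_pmf (pmf_of_set {..<n})) borel x)"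
    using A by simp
  also have "\<dots> = (\<integral>\<^sup>+i. indicator A (x i) \<partial>measure_pmf (pmf_of_set {..<n}))"
    using A by (intro nn_integral_distr) auto
  also have "\<dots> = (\<Sum>i<n. indicator A (x i)) / of_nat n"
    using ne by (simp add: nn_integral_pmf_of_set)
  also have "\<dots> = emeasure (empirical_measure n x) A"
    using A by (simp add: emeasure_empirical_measure)
  finally show "emeasure (empirical_measure n x) A
      = emeasure (distr (measure_pmf (pmf_of_set {..<n})) borel x) A" ..
qed simp

lemma prob_space_empirical_measure:
  fixes x :: "nat \<Rightarrow> 'a::euclidean_space"
  assumes "n \<ge> 1"
  shows "prob_space (empirical_measure n x)"
  unfolding empirical_measure_eq_distr[OF assms]
  by (rule prob_space.prob_space_distr) (auto simp: measure_pmf.prob_space_axioms)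

lemma smooth_pdf_empirical_measure:
  fixes x :: "nat \<Rightarrow> 'a::euclidean_space"
  assumes "n \<ge> 1"
  shows "smooth_pdf \<sigma> (empirical_measure n x) y = (\<Sum>i<n. gauss_pdf \<sigma> (y - x i)) / n"
proof -
  have ne: "{..<n} \<noteq> {}" using assms by (simp add: lessThan_empty_iff)
  show ?thesis
    unfolding smooth_pdf_def empirical_measure_eq_distr[OF assms]
    using ne by (subst integral_distr) (auto simp: integral_pmf_of_set)
qed

lemma empirical_measure_exp_norm_finite:
  fixes x :: "nat \<Rightarrow> 'a::euclidean_space"
  assumes "n \<ge> 1"
  shows "(\<integral>\<^sup>+z. ennreal (exp (2 * norm z)) \<partial>empirical_measure n x) < \<infinity>"
proof -
  have ne: "{..<n} \<noteq> {}" using assms by (simp add: lessThan_empty_iff)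
  show ?thesis
    unfolding empirical_measure_eq_distr[OF assms]
    using ne assms by (subst nn_integral_distr) (auto simp: nn_integral_pmf_of_set ennreal_of_nat_eq_real_of_nat divide_ennreal sum_nonneg)
qed

text \<open>
  For \<open>u = x - mean \<mu>\<close>, the norm of \<open>u\<close> is at most \<open>DIM('a)\<close> times the largest coordinate of \<open>u\<close> in absolute value, so
  \<open>exp (2 * norm u)\<close> is dominated by the sum over all coordinates of two exponentials of linear forms. These
  are integrable by the finiteness of the moment generating function.
\<close>

lemma subgaussian_exp_norm_finite:
  fixes \<mu> :: "'a::euclidean_space measure"
  assumes "sets \<mu> = sets borel" "subgaussian K \<mu>"
  shows "(\<integral>\<^sup>+x. ennreal (exp (2 * norm x)) \<partial>\<mu>) < \<infinity>"
proof -
  define d where "d = real DIM('a)"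
  define F where "F = (\<lambda>x::'a. \<Sum>b\<in>Basis. exp ((2 * d) *\<^sub>R b \<bullet> (x - mean \<mu>)) + exp ((- 2 * d) *\<^sub>R b \<bullet> (x - mean \<mu>)))"
  have mgf: "integrable \<mu> (\<lambda>x. exp (l \<bullet> (x - mean \<mu>)))" for l
    using assms(2) by (simp add: subgaussian_def)
  have int: "integrable \<mu> F"
    unfolding F_def
    by (intro Bochner_Integration.integrable_sum Bochner_Integration.integrable_add mgf)
  have F_nonneg: "0 \<le> F x" for x
    unfolding F_def by (intro sum_nonneg add_nonneg_nonneg) auto
  have F: "exp (2 * norm x) \<le> exp (2 * norm (mean \<mu>)) * F x" for x
  proof -
    define u where "u = x - mean \<mu>"
    obtain b where b: "b \<in> Basis" "Max ((\<lambda>b'. \<bar>u \<bullet> b'\<bar>) ` Basis) = \<bar>u \<bullet> b\<bar>"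
      by (rule obtains_MAX[OF finite_Basis nonempty_Basis])
    have le_b: "\<bar>u \<bullet> b'\<bar> \<le> \<bar>u \<bullet> b\<bar>" if "b' \<in> Basis" for b'
      unfolding b(2)[symmetric] using that by (intro Max_ge) auto
    have "norm u \<le> (\<Sum>b'\<in>Basis. \<bar>u \<bullet> b'\<bar>)" by (rule norm_le_l1)
    also have "\<dots> \<le> d * \<bar>u \<bullet> b\<bar>"
      unfolding d_def by (rule sum_bounded_above) (use le_b in auto)
    finally have "exp (2 * norm u) \<le> exp (\<bar>2 * d * (u \<bullet> b)\<bar>)"
      by (simp add: d_def abs_mult)
    also have "\<dots> \<le> exp (2 * d * (u \<bullet> b)) + exp (- 2 * d * (u \<bullet> b))"
      by (simp add: abs_if)
    also have "\<dots> = exp ((2 * d) *\<^sub>R b \<bullet> u) + exp ((- 2 * d) *\<^sub>R b \<bullet> u)"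
      by (simp add: inner_commute)
    also have "\<dots> \<le> F x"
      unfolding F_def u_def[symmetric] using b(1) by (intro member_le_sum) (auto intro: add_nonneg_nonneg)
    finally have "exp (2 * norm u) \<le> F x" .
    moreover have "norm x \<le> norm (mean \<mu>) + norm u"
      unfolding u_def by (metis add_diff_cancel_left' add.commute diff_add_cancel norm_triangle_ineq)
    then have "exp (2 * norm x) \<le> exp (2 * norm (mean \<mu>)) * exp (2 * norm u)"
      by (simp add: exp_add[symmetric])
    ultimately show ?thesis
      by (meson exp_ge_zero mult_left_mono order_trans)
  qed
  have "(\<integral>\<^sup>+x. ennreal (exp (2 * norm x)) \<partial>\<mu>) \<le> (\<integral>\<^sup>+x. ennreal (exp (2 * norm (mean \<mu>)) * F x) \<partial>\<mu>)"
    by (intro nn_integral_mono ennreal_leI F)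
  also have "\<dots> < \<infinity>"
    using int F_nonneg by (subst nn_integral_eq_integral) auto
  finally show ?thesis .
qed

section \<open>Relative entropy of smoothed distributions\<close>

context
  fixes \<mu> :: "'a::ordered_euclidean_space measure" and \<sigma> :: real
  assumes \<mu>: "prob_space \<mu>" "sets \<mu> = sets borel" and \<sigma>: "\<sigma> > 0"
begin

interpretation borel_prob \<mu>
  by (simp add: borel_prob_def borel_prob_axioms_def \<mu>)

lemma integrable_smooth_pdf: "integrable lborel (smooth_pdf \<sigma> \<mu>)"
  using nn_integral_smooth_pdf[OF \<mu> \<sigma>] smooth_pdf_pos[OF \<sigma>]
  by (intro integrableI_bounded) (auto simp: abs_of_pos)

lemma integral_smooth_pdf: "(\<integral>y. smooth_pdf \<sigma> \<mu> y \<partial>lborel) = 1"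
  using nn_integral_smooth_pdf[OF \<mu> \<sigma>] smooth_pdf_pos[OF \<sigma>]
  by (subst integral_eq_nn_integral) (auto intro: less_imp_le)

end

context
  fixes \<mu> \<nu> :: "'a::ordered_euclidean_space measure" and \<sigma> :: real
  assumes \<mu>: "prob_space \<mu>" "sets \<mu> = sets borel"
    and \<nu>: "prob_space \<nu>" "sets \<nu> = sets borel"
    and \<sigma>: "\<sigma> > 0"
    and exp_norm: "(\<integral>\<^sup>+x. ennreal (exp (2 * norm x)) \<partial>\<mu>) < \<infinity>"
begin

interpretation mu: borel_prob \<mu>
  by (simp add: borel_prob_def borel_prob_axioms_def \<mu>)

interpretation nu: borel_prob \<nu>
  by (simp add: borel_prob_def borel_prob_axioms_def \<nu>)

text \<open>
  Both densities lie between the peak of the Gaussian kernel and that peak times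
  \<open>exp (- L * exp (norm y))\<close>, so the logarithm of their ratio is at most a multiple of \<open>exp (norm y)\<close>, which the
  exponential moment of \<open>\<mu>\<close> controls.
\<close>

lemma integrable_smooth_pdf_mult_ln:
  "integrable lborel (\<lambda>y. smooth_pdf \<sigma> \<mu> y * ln (smooth_pdf \<sigma> \<mu> y / smooth_pdf \<sigma> \<nu> y))"
proof -
  let ?p = "smooth_pdf \<sigma> \<mu>" and ?q = "smooth_pdf \<sigma> \<nu>" and ?c = "gauss_pdf \<sigma> (0::'a)"
  obtain L1 where L1: "L1 \<ge> 1" "\<And>y. ?c * exp (- L1 * exp (norm y)) \<le> ?p y"
    using mu.smooth_pdf_lower_bound[OF \<sigma>] by blast
  obtain L2 where L2: "L2 \<ge> 1" "\<And>y. ?c * exp (- L2 * exp (norm y)) \<le> ?q y"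
    using nu.smooth_pdf_lower_bound[OF \<sigma>] by blast
  note pos = mu.smooth_pdf_pos[OF \<sigma>] nu.smooth_pdf_pos[OF \<sigma>] gauss_pdf_pos[OF \<sigma>, of "0::'a"]
  have bound: "\<bar>?p y * ln (?p y / ?q y)\<bar> \<le> (L1 + L2) * (?p y * exp (2 * norm y))" for y
  proof -
    have "ln (?c * exp (- L1 * exp (norm y))) \<le> ln (?p y)"
      using L1(2)[of y] pos by (subst ln_le_cancel_iff) auto
    then have p_ge: "ln ?c - L1 * exp (norm y) \<le> ln (?p y)"
      using pos by (simp add: ln_mult)
    have "ln (?c * exp (- L2 * exp (norm y))) \<le> ln (?q y)"
      using L2(2)[of y] pos by (subst ln_le_cancel_iff) auto
    then have q_ge: "ln ?c - L2 * exp (norm y) \<le> ln (?q y)"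
      using pos by (simp add: ln_mult)
    have le: "ln (?p y) \<le> ln ?c" "ln (?q y) \<le> ln ?c"
      using pos mu.smooth_pdf_le_peak[OF \<sigma>, of y] nu.smooth_pdf_le_peak[OF \<sigma>, of y] by auto
    have "0 \<le> L1 * exp (norm y)" "0 \<le> L2 * exp (norm y)" using L1(1) L2(1) by auto
    then have "\<bar>ln (?p y / ?q y)\<bar> \<le> (L1 + L2) * exp (norm y)"
      using p_ge q_ge le pos(1,2)[of y] by (simp add: ln_div distrib_right abs_le_iff)
    also have "\<dots> \<le> (L1 + L2) * exp (2 * norm y)"
      using L1(1) L2(1) by (intro mult_left_mono) auto
    finally have "?p y * \<bar>ln (?p y / ?q y)\<bar> \<le> ?p y * ((L1 + L2) * exp (2 * norm y))"
      using pos(1)[of y] by (intro mult_left_mono) auto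
    then show ?thesis using pos(1)[of y] by (simp add: abs_mult mult.left_commute)
  qed
  have "integrable lborel (\<lambda>y. ?p y * exp (2 * norm y))"
    using smooth_pdf_exp_norm_finite[OF \<mu> \<sigma> exp_norm] pos(1)
    by (intro integrableI_bounded) (auto simp: abs_mult abs_of_pos)
  then have "integrable lborel (\<lambda>y. (L1 + L2) * (?p y * exp (2 * norm y)))"
    by simp
  then show ?thesis
    by (rule Bochner_Integration.integrable_bound)
       (auto intro!: AE_I2 order_trans[OF bound])
qed

lemma D_KL_convolution_gaussian:
  "D_KL (\<mu> \<star> gaussian \<sigma>) (\<nu> \<star> gaussian \<sigma>)
    = (\<integral>y. smooth_pdf \<sigma> \<mu> y * ln (smooth_pdf \<sigma> \<mu> y / smooth_pdf \<sigma> \<nu> y) \<partial>lborel)"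
  unfolding D_KL_def convolution_gaussian_eq_density[OF \<mu> \<sigma>] convolution_gaussian_eq_density[OF \<nu> \<sigma>]
  using mu.smooth_pdf_pos[OF \<sigma>] nu.smooth_pdf_pos[OF \<sigma>]
  by (subst lborel.KL_density_density) (auto simp: log_def less_imp_le less_imp_neq[symmetric])

text \<open>
  The Radon-Nikodym derivative is the quotient of the two positive Lebesgue densities, which reduces
  the claim to the integrability just shown.
\<close>

lemma finite_D_KL_convolution_gaussian:
  "finite_D_KL (\<mu> \<star> gaussian \<sigma>) (\<nu> \<star> gaussian \<sigma>)"
proof -
  let ?p = "smooth_pdf \<sigma> \<mu>" and ?q = "smooth_pdf \<sigma> \<nu>"
  let ?M = "density lborel (\<lambda>y. ennreal (?p y))" and ?N = "density lborel (\<lambda>y. ennreal (?q y))"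
  note pos = mu.smooth_pdf_pos[OF \<sigma>] nu.smooth_pdf_pos[OF \<sigma>]
  interpret N: prob_space ?N
    by standard (simp add: emeasure_density nn_integral_smooth_pdf[OF \<nu> \<sigma>])
  have M: "?M = density ?N (\<lambda>y. ennreal (?p y / ?q y))"
    using pos by (subst density_density_divide) (auto simp: less_imp_le less_imp_neq[symmetric])
  have ac: "absolutely_continuous ?N ?M"
    unfolding M by (rule absolutely_continuousI_density) simp
  have "density ?N (RN_deriv ?N ?M) = density ?N (\<lambda>y. ennreal (?p y / ?q y))"
    unfolding M by (rule density_RN_deriv_density) simp
  then have "AE y in ?N. RN_deriv ?N ?M y = ennreal (?p y / ?q y)"
    by (intro N.density_unique) auto
  then have "AE y in ?M. RN_deriv ?N ?M y = ennreal (?p y / ?q y)"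
    by (rule absolutely_continuous_AE[OF _ ac, rotated]) simp
  then have "AE y in ?M. entropy_density (exp 1) ?N ?M y = ln (?p y / ?q y)"
    using pos by (auto simp: entropy_density_def log_def less_imp_le)
  moreover have "integrable ?M (\<lambda>y. ln (?p y / ?q y))"
    using integrable_smooth_pdf_mult_ln pos
    by (subst integrable_density) (auto simp: less_imp_le)
  moreover have "entropy_density (exp 1) ?N ?M \<in> borel_measurable ?M"
    using measurable_entropy_density[of "exp 1" ?N ?M] by simp
  ultimately have "integrable ?M (entropy_density (exp 1) ?N ?M)"
    by (subst integrable_cong_AE) auto
  with ac show ?thesis
    unfolding finite_D_KL_def convolution_gaussian_eq_density[OF \<mu> \<sigma>]
      convolution_gaussian_eq_density[OF \<nu> \<sigma>] by simp
qed

end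

section \<open>Relative entropy of an empirical mean\<close>

text \<open>
  Write \<open>S\<close> for the empirical mean of the \<open>Z i\<close>. If one summand \<open>Z i\<close> is fixed, then the mean of the other
  summands is \<open>m\<close>, so the expectation of \<open>S / m\<close> is at most \<open>a = 1 + Z i / (n * m)\<close>. Bounding \<open>ln (S / m)\<close> by its
  tangent line at \<open>a\<close> turns this into Jensen's inequality conditional on \<open>Z i\<close>; after multiplication by
  \<open>Z i\<close>, independence factorises the expectations of the terms with two distinct indices. The gain over
  \<open>ln (S / m) \<le> S / m - 1\<close> is that the resulting bound stays logarithmic where \<open>Z i / m\<close> is huge.
\<close>

lemma (in prob_space)
  fixes Z :: "nat \<Rightarrow> 'a \<Rightarrow> real"
  assumes n: "n \<ge> 1"
    and indep: "indep_vars (\<lambda>_. borel) Z {..<n}"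
    and distr: "\<And>i. i < n \<Longrightarrow> distr M borel (Z i) = D"
    and pos: "\<And>i \<omega>. i < n \<Longrightarrow> 0 < Z i \<omega>"
    and le: "\<And>i \<omega>. i < n \<Longrightarrow> Z i \<omega> \<le> c"
    and m: "m = (\<integral>z. z \<partial>D)" "m > 0"
  shows integrable_mean_ln_mean:
      "integrable M (\<lambda>\<omega>. (\<Sum>i<n. Z i \<omega>) / n * ln ((\<Sum>i<n. Z i \<omega>) / n / m))" (is ?integrable)
    and expectation_mean_ln_mean_le:
      "expectation (\<lambda>\<omega>. (\<Sum>i<n. Z i \<omega>) / n * ln ((\<Sum>i<n. Z i \<omega>) / n / m))
      \<le> (\<integral>z. z * ln (1 + z / (n * m)) \<partial>D)" (is ?bound)
proof -
  define S where "S = (\<lambda>\<omega>. (\<Sum>i<n. Z i \<omega>) / n)"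
  define a where "a = (\<lambda>z. 1 + z / (real n * m))"
  have n0: "real n > 0" using n by simp
  have Z_meas [measurable]: "Z i \<in> borel_measurable M" if "i < n" for i
    using indep that by (auto simp: indep_vars_def)
  have S_meas [measurable]: "S \<in> borel_measurable M"
    unfolding S_def by measurable
  have a_meas [measurable]: "a \<in> borel_measurable borel"
    unfolding a_def by measurable
  have a_ge: "a (Z i \<omega>) \<ge> 1" if "i < n" for i \<omega>
    using pos[OF that, of \<omega>] m(2) n0 by (simp add: a_def)
  have S_pos: "S \<omega> > 0" for \<omega>
    unfolding S_def using n pos by (intro divide_pos_pos sum_pos) (auto simp: lessThan_empty_iff)
  have S_le: "S \<omega> \<le> c" for \<omega>
  proof -
    have "(\<Sum>i<n. Z i \<omega>) \<le> real (card {..<n}) * c"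
      by (rule sum_bounded_above) (use le in auto)
    then show ?thesis using n0 by (simp add: S_def divide_le_eq mult.commute)
  qed
  have E_Z: "expectation (\<lambda>\<omega>. f (Z i \<omega>)) = (\<integral>z. f z \<partial>D)"
    if "i < n" "f \<in> borel_measurable borel" for i and f :: "real \<Rightarrow> real"
    using that by (simp add: distr[OF that(1), symmetric] integral_distr)
  have int: "integrable M f" if "f \<in> borel_measurable M" "\<And>\<omega>. 0 \<le> f \<omega>" "\<And>\<omega>. f \<omega> \<le> C"
    for f :: "'a \<Rightarrow> real" and C
    using that by (intro integrable_const_bound[of _ C]) auto
  have int_Z: "integrable M (Z i)" if "i < n" for i
    by (rule int[of _ c]) (use that pos le in \<open>auto intro: less_imp_le\<close>)
  have ln_a: "0 \<le> ln (a (Z i \<omega>))" "ln (a (Z i \<omega>)) \<le> ln (a c)" if "i < n" for i \<omega>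
  proof -
    show "0 \<le> ln (a (Z i \<omega>))" using a_ge[OF that] by simp
    have "a (Z i \<omega>) \<le> a c"
      unfolding a_def using le[OF that] m(2) n0 by (intro add_left_mono divide_right_mono) auto
    then show "ln (a (Z i \<omega>)) \<le> ln (a c)" using a_ge[OF that, of \<omega>] by simp
  qed
  have int_Zln: "integrable M (\<lambda>\<omega>. Z i \<omega> * ln (a (Z i \<omega>)))" if i: "i < n" for i
  proof (rule int[of _ "c * ln (a c)"])
    show "(\<lambda>\<omega>. Z i \<omega> * ln (a (Z i \<omega>))) \<in> borel_measurable M" using i by measurable
    show "0 \<le> Z i \<omega> * ln (a (Z i \<omega>))" for \<omega>
      using pos[OF i, of \<omega>] ln_a[OF i, of \<omega>] by simp
    show "Z i \<omega> * ln (a (Z i \<omega>)) \<le> c * ln (a c)" for \<omega>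
      using pos[OF i, of \<omega>] le[OF i, of \<omega>] ln_a[OF i, of \<omega>] by (intro mult_mono) auto
  qed
  have Za: "0 < Z i \<omega> / a (Z i \<omega>)" "Z i \<omega> / a (Z i \<omega>) \<le> c" if i: "i < n" for i \<omega>
  proof -
    show "0 < Z i \<omega> / a (Z i \<omega>)" using pos[OF i, of \<omega>] a_ge[OF i, of \<omega>] by simp
    have "Z i \<omega> / a (Z i \<omega>) \<le> Z i \<omega> / 1"
      using pos[OF i, of \<omega>] a_ge[OF i, of \<omega>] by (intro divide_left_mono) auto
    then show "Z i \<omega> / a (Z i \<omega>) \<le> c" using le[OF i, of \<omega>] by simp
  qed
  have int_Za: "integrable M (\<lambda>\<omega>. Z i \<omega> / a (Z i \<omega>))" if i: "i < n" for i
    by (rule int[of _ c]) (use i Za[OF i] in \<open>auto intro: less_imp_le\<close>)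
  have int_ZaZ: "integrable M (\<lambda>\<omega>. Z i \<omega> / a (Z i \<omega>) * Z j \<omega>)" if i: "i < n" and j: "j < n" for i j
  proof (rule int[of _ "c * c"])
    show "(\<lambda>\<omega>. Z i \<omega> / a (Z i \<omega>) * Z j \<omega>) \<in> borel_measurable M" using i j by measurable
    show "0 \<le> Z i \<omega> / a (Z i \<omega>) * Z j \<omega>" for \<omega>
      using Za[OF i, of \<omega>] pos[OF j, of \<omega>] by (intro mult_nonneg_nonneg) auto
    show "Z i \<omega> / a (Z i \<omega>) * Z j \<omega> \<le> c * c" for \<omega>
      using Za[OF i, of \<omega>] pos[OF j, of \<omega>] le[OF j, of \<omega>] by (intro mult_mono) auto
  qed
  have E_prod: "expectation (\<lambda>\<omega>. Z i \<omega> / a (Z i \<omega>) * Z j \<omega>)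
      = expectation (\<lambda>\<omega>. Z i \<omega> / a (Z i \<omega>)) * m"
    if i: "i < n" and j: "j < n" and "i \<noteq> j" for i j
  proof -
    have "indep_var borel (Z i) borel (Z j)"
      using indep_vars_sum[of "{j}" i Z] indep_vars_subset[OF indep, of "{i, j}"] that by simp
    then have "indep_var borel ((\<lambda>z. z / a z) \<circ> Z i) borel ((\<lambda>z. z) \<circ> Z j)"
      by (rule indep_var_compose) measurable
    then have "expectation (\<lambda>\<omega>. Z i \<omega> / a (Z i \<omega>) * Z j \<omega>)
        = expectation (\<lambda>\<omega>. Z i \<omega> / a (Z i \<omega>)) * expectation (Z j)"
      using int_Za[OF i] int_Z[OF j]
      by (subst indep_var_lebesgue_integral[symmetric]) (auto simp: comp_def)
    then show ?thesis using E_Z[OF j, of "\<lambda>z. z"] m by simp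
  qed
  have int_ZaS: "integrable M (\<lambda>\<omega>. Z i \<omega> / a (Z i \<omega>) * S \<omega>)" if i: "i < n" for i
  proof (rule int[of _ "c * c"])
    show "(\<lambda>\<omega>. Z i \<omega> / a (Z i \<omega>) * S \<omega>) \<in> borel_measurable M" using i by measurable
    show "0 \<le> Z i \<omega> / a (Z i \<omega>) * S \<omega>" for \<omega>
      using Za[OF i, of \<omega>] S_pos[of \<omega>] by (intro mult_nonneg_nonneg) auto
    show "Z i \<omega> / a (Z i \<omega>) * S \<omega> \<le> c * c" for \<omega>
      using Za[OF i, of \<omega>] S_pos[of \<omega>] S_le[of \<omega>] by (intro mult_mono) auto
  qed
  \<comment> \<open>The right-hand side is what the tangent bound needs: the linear terms then cancel in the mean.\<close>
  have E_ZaS: "expectation (\<lambda>\<omega>. Z i \<omega> / a (Z i \<omega>) * S \<omega>) \<le> m * m" if i: "i < n" for i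
  proof -
    define e where "e = expectation (\<lambda>\<omega>. Z i \<omega> / a (Z i \<omega>))"
    define s where "s = expectation (\<lambda>\<omega>. Z i \<omega> / a (Z i \<omega>) * Z i \<omega>)"
    have e0: "e \<ge> 0"
      unfolding e_def by (rule integral_nonneg_AE) (use Za[OF i] in \<open>auto intro: less_imp_le\<close>)
    have "expectation (\<lambda>\<omega>. Z i \<omega> / a (Z i \<omega>) * S \<omega>)
        = expectation (\<lambda>\<omega>. (\<Sum>j<n. Z i \<omega> / a (Z i \<omega>) * Z j \<omega>) / n)"
      by (simp add: S_def sum_distrib_left)
    also have "\<dots> = (\<Sum>j<n. expectation (\<lambda>\<omega>. Z i \<omega> / a (Z i \<omega>) * Z j \<omega>)) / n"
      using int_ZaZ[OF i] by (simp add: Bochner_Integration.integral_sum)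
    also have "(\<Sum>j<n. expectation (\<lambda>\<omega>. Z i \<omega> / a (Z i \<omega>) * Z j \<omega>))
        = s + (\<Sum>j\<in>{..<n} - {i}. e * m)"
      using i E_prod[OF i] by (subst sum.remove[of _ i]) (auto simp: s_def e_def)
    also have "(\<Sum>j\<in>{..<n} - {i}. e * m) = (real n - 1) * (e * m)"
      using i by (simp add: of_nat_diff)
    also have "(s + (real n - 1) * (e * m)) / n \<le> (s + n * (e * m)) / n"
      using e0 m(2) n0 by (intro divide_right_mono add_left_mono mult_right_mono) auto
    also have "\<dots> = expectation (\<lambda>\<omega>. m * Z i \<omega>)"
    proof -
      have eq: "m * Z i \<omega> = (Z i \<omega> / a (Z i \<omega>) * Z i \<omega>) / n + m * (Z i \<omega> / a (Z i \<omega>))" for \<omega>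
      proof -
        have "m * Z i \<omega> = m * (Z i \<omega> / a (Z i \<omega>)) * a (Z i \<omega>)"
          using a_ge[OF i, of \<omega>] by simp
        also have "\<dots> = (Z i \<omega> / a (Z i \<omega>) * Z i \<omega>) / n + m * (Z i \<omega> / a (Z i \<omega>))"
          unfolding a_def using m(2) n0 by (simp add: distrib_left)
        finally show ?thesis .
      qed
      have "expectation (\<lambda>\<omega>. m * Z i \<omega>)
          = expectation (\<lambda>\<omega>. (Z i \<omega> / a (Z i \<omega>) * Z i \<omega>) / n + m * (Z i \<omega> / a (Z i \<omega>)))"
        by (rule Bochner_Integration.integral_cong[OF refl eq])
      also have "\<dots> = expectation (\<lambda>\<omega>. (Z i \<omega> / a (Z i \<omega>) * Z i \<omega>) / n)
          + expectation (\<lambda>\<omega>. m * (Z i \<omega> / a (Z i \<omega>)))"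
        by (intro Bochner_Integration.integral_add integrable_divide integrable_mult_right
            int_ZaZ[OF i i] int_Za[OF i])
      also have "\<dots> = s / n + m * e"
        unfolding s_def e_def
        by (simp only: integral_divide_zero integral_mult_right_zero)
      finally have "expectation (\<lambda>\<omega>. m * Z i \<omega>) = s / n + m * e" .
      then show ?thesis using n0 by (simp add: add_divide_distrib)
    qed
    also have "\<dots> = m * m" using E_Z[OF i, of "\<lambda>z. z"] m by simp
    finally show ?thesis .
  qed
  let ?R = "\<lambda>\<omega>. (\<Sum>i<n. Z i \<omega> * ln (a (Z i \<omega>)) + Z i \<omega> / a (Z i \<omega>) * S \<omega> / m - Z i \<omega>) / n"
  let ?T = "\<lambda>i \<omega>. Z i \<omega> * ln (a (Z i \<omega>)) + Z i \<omega> / a (Z i \<omega>) * S \<omega> / m - Z i \<omega>"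
  have int_sum: "integrable M (\<lambda>\<omega>. Z i \<omega> * ln (a (Z i \<omega>)) + Z i \<omega> / a (Z i \<omega>) * S \<omega> / m)"
    if "i < n" for i
    by (intro Bochner_Integration.integrable_add integrable_divide int_Zln int_ZaS that)
  have int_T: "integrable M (?T i)" if "i < n" for i
    by (intro Bochner_Integration.integrable_diff int_sum int_Z that)
  have int_R: "integrable M ?R"
    by (intro integrable_divide Bochner_Integration.integrable_sum int_T) simp
  have E_T: "expectation (?T i) = expectation (\<lambda>\<omega>. Z i \<omega> * ln (a (Z i \<omega>)))
      + expectation (\<lambda>\<omega>. Z i \<omega> / a (Z i \<omega>) * S \<omega>) / m - expectation (Z i)" if i: "i < n" for i
    unfolding Bochner_Integration.integral_diff[OF int_sum[OF i] int_Z[OF i]]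
      Bochner_Integration.integral_add[OF int_Zln[OF i] integrable_divide[OF int_ZaS[OF i]]]
      integral_divide_zero ..
  have pt: "S \<omega> * ln (S \<omega> / m) \<le> ?R \<omega>" for \<omega>
  proof -
    have "S \<omega> * ln (S \<omega> / m) = (\<Sum>i<n. Z i \<omega> * ln (S \<omega> / m)) / n"
      by (simp add: S_def sum_distrib_right)
    also have "\<dots> \<le> ?R \<omega>"
    proof (intro divide_right_mono sum_mono)
      fix i assume "i \<in> {..<n}"
      then have i: "i < n" by simp
      have "ln (S \<omega> / m) \<le> ln (a (Z i \<omega>)) + (S \<omega> / m) / a (Z i \<omega>) - 1"
        using S_pos[of \<omega>] m(2) a_ge[OF i, of \<omega>] by (intro ln_le_tangent) auto
      then have "Z i \<omega> * ln (S \<omega> / m) \<le> Z i \<omega> * (ln (a (Z i \<omega>)) + (S \<omega> / m) / a (Z i \<omega>) - 1)"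
        using pos[OF i, of \<omega>] by (intro mult_left_mono) auto
      then show "Z i \<omega> * ln (S \<omega> / m)
          \<le> Z i \<omega> * ln (a (Z i \<omega>)) + Z i \<omega> / a (Z i \<omega>) * S \<omega> / m - Z i \<omega>"
        by (simp add: algebra_simps)
    qed simp
    finally show ?thesis .
  qed
  have int_S: "integrable M (\<lambda>\<omega>. S \<omega> * ln (S \<omega> / m))"
  proof -
    have "S \<omega> * ln (S \<omega> / m) \<ge> - m" for \<omega>
      using mult_ln_divide_minus_nonneg[OF S_pos m(2), of \<omega>] S_pos[of \<omega>] by linarith
    then have "\<bar>S \<omega> * ln (S \<omega> / m)\<bar> \<le> m + \<bar>?R \<omega>\<bar>" for \<omega>
      using pt[of \<omega>] m(2) by (smt (verit))
    moreover have "integrable M (\<lambda>\<omega>. m + \<bar>?R \<omega>\<bar>)"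
      by (intro Bochner_Integration.integrable_add integrable_abs int_R) simp
    ultimately show ?thesis
      by (elim Bochner_Integration.integrable_bound) (auto intro!: AE_I2 order_trans[OF _ abs_ge_self])
  qed
  then show ?integrable by (simp add: S_def)
  have "expectation (\<lambda>\<omega>. S \<omega> * ln (S \<omega> / m)) \<le> expectation ?R"
    by (rule integral_mono[OF int_S int_R pt])
  also have "expectation ?R = (\<Sum>i<n. expectation (?T i)) / n"
    unfolding integral_divide_zero
    by (subst Bochner_Integration.integral_sum[OF int_T]) simp_all
  also have "\<dots> \<le> (\<Sum>i<n. (\<integral>z. z * ln (a z) \<partial>D)) / n"
  proof (intro divide_right_mono sum_mono)
    fix i assume "i \<in> {..<n}"
    then have i: "i < n" by simp
    have "expectation (\<lambda>\<omega>. Z i \<omega> / a (Z i \<omega>) * S \<omega>) / m \<le> m"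
      using E_ZaS[OF i] m(2) by (simp add: divide_le_eq)
    moreover have "expectation (Z i) = m"
      using E_Z[OF i, of "\<lambda>z. z"] m by simp
    moreover have "expectation (\<lambda>\<omega>. Z i \<omega> * ln (a (Z i \<omega>))) = (\<integral>z. z * ln (a z) \<partial>D)"
      by (rule E_Z[OF i]) measurable
    ultimately show "expectation (?T i) \<le> (\<integral>z. z * ln (a z) \<partial>D)"
      unfolding E_T[OF i] by linarith
  qed simp
  also have "\<dots> = (\<integral>z. z * ln (a z) \<partial>D)" using n by simp
  finally show ?bound by (simp add: S_def a_def)
qed

section \<open>Integrating the pointwise bound\<close>

text \<open>
  The pointwise bound for the expected integrand of the divergence: the right-hand side of
  \<open>expectation_mean_ln_mean_le\<close> for the summands \<open>gauss_pdf \<sigma> (y - X i)\<close>, whose common mean is the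
  smoothed density of \<open>P\<close> at \<open>y\<close>.
\<close>

definition kl_bound_integrand :: "real \<Rightarrow> 'a::euclidean_space measure \<Rightarrow> nat \<Rightarrow> 'a \<Rightarrow> real"
  where "kl_bound_integrand \<sigma> P n y =
    (\<integral>x. gauss_pdf \<sigma> (y - x) * ln (1 + gauss_pdf \<sigma> (y - x) / (n * smooth_pdf \<sigma> P y)) \<partial>P)"

context borel_prob
begin

context
  fixes \<sigma> :: real and n :: nat
  assumes \<sigma>: "\<sigma> > 0" and n: "n \<ge> 1"
begin

lemma kl_bound_integrand_measurable [measurable]:
  "kl_bound_integrand \<sigma> \<mu> n \<in> borel_measurable borel"
  unfolding kl_bound_integrand_def[abs_def] by measurable

lemma integrable_gauss_pdf_ln_term:
  "integrable \<mu> (\<lambda>x. gauss_pdf \<sigma> (y - x) * ln (1 + gauss_pdf \<sigma> (y - x) / (n * smooth_pdf \<sigma> \<mu> y)))"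
  (is "integrable \<mu> ?f")
proof (rule integrable_const_bound)
  let ?c = "gauss_pdf \<sigma> (0::'a)" and ?p = "smooth_pdf \<sigma> \<mu> y"
  have "\<bar>?f x\<bar> \<le> ?c * ln (1 + ?c / (n * ?p))" for x
  proof -
    have "0 < gauss_pdf \<sigma> (y - x)" "gauss_pdf \<sigma> (y - x) \<le> ?c" "0 < n * ?p"
      using gauss_pdf_pos[OF \<sigma>] gauss_pdf_le_peak[OF \<sigma>] smooth_pdf_pos[OF \<sigma>] n by auto
    then have "0 < gauss_pdf \<sigma> (y - x) / (n * ?p)" "gauss_pdf \<sigma> (y - x) / (n * ?p) \<le> ?c / (n * ?p)"
      by (auto intro: divide_pos_pos divide_right_mono)
    then have "0 \<le> ln (1 + gauss_pdf \<sigma> (y - x) / (n * ?p))"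
        "ln (1 + gauss_pdf \<sigma> (y - x) / (n * ?p)) \<le> ln (1 + ?c / (n * ?p))"
      by auto
    with \<open>0 < gauss_pdf \<sigma> (y - x)\<close> \<open>gauss_pdf \<sigma> (y - x) \<le> ?c\<close> show ?thesis
      by (auto simp: abs_mult intro!: mult_mono)
  qed
  then show "AE x in \<mu>. norm (?f x) \<le> ?c * ln (1 + ?c / (n * ?p))" by simp
qed measurable

text \<open>
  The bound for the bulk: by \<open>ln (1 + t) \<le> t\<close> the integrand is at most
  \<open>(gauss_pdf \<sigma> (y - x))\<^sup>2 / (n * p)\<close> for the smoothed density \<open>p\<close> at \<open>y\<close>. Replacing one of the two kernels by its
  peak leaves a kernel whose mean cancels \<open>p\<close>, so the estimate is uniform in \<open>y\<close>.
\<close>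

lemma kl_bound_integrand_le_peak: "kl_bound_integrand \<sigma> \<mu> n y \<le> gauss_pdf \<sigma> (0::'a) / n"
proof -
  let ?c = "gauss_pdf \<sigma> (0::'a)" and ?p = "smooth_pdf \<sigma> \<mu> y"
  have p: "?p > 0" by (rule smooth_pdf_pos[OF \<sigma>])
  have le: "gauss_pdf \<sigma> (y - x) * ln (1 + gauss_pdf \<sigma> (y - x) / (n * ?p))
      \<le> ?c / (n * ?p) * gauss_pdf \<sigma> (y - x)" for x
  proof -
    have g: "0 < gauss_pdf \<sigma> (y - x)" "gauss_pdf \<sigma> (y - x) \<le> ?c"
      using gauss_pdf_pos[OF \<sigma>] gauss_pdf_le_peak[OF \<sigma>] by auto
    have "ln (1 + gauss_pdf \<sigma> (y - x) / (n * ?p)) \<le> gauss_pdf \<sigma> (y - x) / (n * ?p)"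
      using g p n by (intro ln_add_one_self_le_self) auto
    also have "\<dots> \<le> ?c / (n * ?p)"
      using g p n by (intro divide_right_mono) auto
    finally have "gauss_pdf \<sigma> (y - x) * ln (1 + gauss_pdf \<sigma> (y - x) / (n * ?p))
        \<le> gauss_pdf \<sigma> (y - x) * (?c / (n * ?p))"
      using g by (intro mult_left_mono) auto
    then show ?thesis by (simp add: mult.commute)
  qed
  have "kl_bound_integrand \<sigma> \<mu> n y \<le> (\<integral>x. ?c / (n * ?p) * gauss_pdf \<sigma> (y - x) \<partial>\<mu>)"
    unfolding kl_bound_integrand_def
    by (intro integral_mono integrable_gauss_pdf_ln_term le integrable_mult_right integrable_gauss_pdf \<sigma>)
  also have "\<dots> = ?c / (n * ?p) * ?p"
    by (simp add: smooth_pdf_def)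
  also have "\<dots> = ?c / n" using p by simp
  finally show ?thesis .
qed

text \<open>
  The bound for the tail: it does not improve with \<open>n\<close>, but it carries the integrable factor
  \<open>smooth_pdf \<sigma> \<mu> y\<close>. The logarithm grows at most like \<open>exp (norm y)\<close> by the lower bound on the density.
\<close>

lemma kl_bound_integrand_le_smooth_pdf:
  assumes L: "L \<ge> 1" "gauss_pdf \<sigma> (0::'a) * exp (- L * exp (norm y)) \<le> smooth_pdf \<sigma> \<mu> y"
  shows "kl_bound_integrand \<sigma> \<mu> n y \<le> 2 * L * exp (norm y) * smooth_pdf \<sigma> \<mu> y"
proof -
  let ?c = "gauss_pdf \<sigma> (0::'a)" and ?p = "smooth_pdf \<sigma> \<mu> y"
  have p: "?p > 0" by (rule smooth_pdf_pos[OF \<sigma>])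
  have c: "?c > 0" by (rule gauss_pdf_pos[OF \<sigma>])
  have e: "1 \<le> L * exp (norm y)"
    using mult_mono[of 1 L 1 "exp (norm y)"] L(1) by simp
  have le: "gauss_pdf \<sigma> (y - x) * ln (1 + gauss_pdf \<sigma> (y - x) / (n * ?p))
      \<le> 2 * L * exp (norm y) * gauss_pdf \<sigma> (y - x)" for x
  proof -
    have g: "0 < gauss_pdf \<sigma> (y - x)" "gauss_pdf \<sigma> (y - x) \<le> ?c"
      using gauss_pdf_pos[OF \<sigma>] gauss_pdf_le_peak[OF \<sigma>] by auto
    have "gauss_pdf \<sigma> (y - x) / (n * ?p) \<le> gauss_pdf \<sigma> (y - x) / ?p"
      using g p n by (intro divide_left_mono) auto
    also have "\<dots> \<le> ?c / (?c * exp (- L * exp (norm y)))"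
      using g p c L(2) by (intro frac_le) auto
    also have "\<dots> = exp (L * exp (norm y))"
      using c by (simp add: exp_minus field_simps)
    finally have "1 + gauss_pdf \<sigma> (y - x) / (n * ?p) \<le> exp (L * exp (norm y)) + exp (L * exp (norm y))"
      using e by (intro add_mono) auto
    also have "\<dots> \<le> exp 1 * exp (L * exp (norm y))"
      using exp_ge_add_one_self[of 1] by simp
    also have "\<dots> \<le> exp (2 * L * exp (norm y))"
      using e by (simp add: exp_add[symmetric])
    finally have "ln (1 + gauss_pdf \<sigma> (y - x) / (n * ?p)) \<le> ln (exp (2 * L * exp (norm y)))"
      using g p n by (subst ln_le_cancel_iff) (auto intro!: add_pos_pos)
    then have "gauss_pdf \<sigma> (y - x) * ln (1 + gauss_pdf \<sigma> (y - x) / (n * ?p))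
        \<le> gauss_pdf \<sigma> (y - x) * (2 * L * exp (norm y))"
      using g by (intro mult_left_mono) auto
    then show ?thesis by (simp add: mult.commute)
  qed
  have "kl_bound_integrand \<sigma> \<mu> n y \<le> (\<integral>x. 2 * L * exp (norm y) * gauss_pdf \<sigma> (y - x) \<partial>\<mu>)"
    unfolding kl_bound_integrand_def
    by (intro integral_mono integrable_gauss_pdf_ln_term le integrable_mult_right integrable_gauss_pdf \<sigma>)
  also have "\<dots> = 2 * L * exp (norm y) * ?p"
    by (simp add: smooth_pdf_def)
  finally show ?thesis .
qed

end
end

lemma emeasure_lborel_centred_cube:
  assumes "R \<ge> 0"
  shows "emeasure lborel (cbox (- (R *\<^sub>R One)) (R *\<^sub>R One :: 'a::euclidean_space))
    = ennreal ((2 * R) ^ DIM('a))"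
  using assms by (subst emeasure_lborel_cbox_eq) (auto simp: algebra_simps)

text \<open>
  The uniform bound is used on the cube with half side \<open>R\<close> and the tail bound outside it, where
  \<open>exp (norm y) \<le> exp (- R) * exp (2 * norm y)\<close>. The constant \<open>B\<close> is independent of \<open>n\<close> and \<open>R\<close>, so that \<open>R\<close> can
  later be chosen depending on \<open>n\<close>.
\<close>

lemma nn_integral_kl_bound_integrand_le:
  fixes P :: "'a::ordered_euclidean_space measure"
  assumes P: "prob_space P" "sets P = sets borel" and \<sigma>: "\<sigma> > 0"
    and exp_norm: "(\<integral>\<^sup>+x. ennreal (exp (2 * norm x)) \<partial>P) < \<infinity>"
  obtains B where "B \<ge> 0"
    and "\<And>n R. n \<ge> 1 \<Longrightarrow> R \<ge> 0 \<Longrightarrow> (\<integral>\<^sup>+y. ennreal (kl_bound_integrand \<sigma> P n y) \<partial>lborel)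
      \<le> ennreal (gauss_pdf \<sigma> (0::'a) / n * (2 * R) ^ DIM('a) + B * exp (- R))"
proof -
  interpret borel_prob P by (simp add: borel_prob_def borel_prob_axioms_def P)
  let ?c = "gauss_pdf \<sigma> (0::'a)" and ?p = "smooth_pdf \<sigma> P"
  note pos = smooth_pdf_pos[OF \<sigma>] gauss_pdf_pos[OF \<sigma>, of "0::'a"]
  obtain L where L: "L \<ge> 1" "\<And>y. ?c * exp (- L * exp (norm y)) \<le> ?p y"
    using smooth_pdf_lower_bound[OF \<sigma>] by blast
  define I where "I = enn2real (\<integral>\<^sup>+y. ennreal (?p y * exp (2 * norm y)) \<partial>lborel)"
  have I: "(\<integral>\<^sup>+y. ennreal (?p y * exp (2 * norm y)) \<partial>lborel) = ennreal I"
    unfolding I_def using smooth_pdf_exp_norm_finite[OF P \<sigma> exp_norm] by simp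
  have I0: "I \<ge> 0" by (simp add: I_def)
  show ?thesis
  proof (rule that[of "2 * L * I"])
    show "2 * L * I \<ge> 0" using L(1) I0 by simp
  next
    fix n :: nat and R :: real assume n: "n \<ge> 1" and R: "R \<ge> 0"
    define C where "C = cbox (- (R *\<^sub>R One)) (R *\<^sub>R One :: 'a)"
    have [measurable]: "C \<in> sets borel" by (simp add: C_def)
    have le: "ennreal (kl_bound_integrand \<sigma> P n y)
        \<le> ennreal (?c / n) * indicator C y + ennreal (2 * L * exp (- R)) * ennreal (?p y * exp (2 * norm y))" for y
    proof (cases "y \<in> C")
      case True
      have "ennreal (kl_bound_integrand \<sigma> P n y) \<le> ennreal (?c / n)"
        by (intro ennreal_leI kl_bound_integrand_le_peak[OF \<sigma> n])
      with True show ?thesis by (simp add: add_increasing2)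
    next
      case False
      then obtain b where b: "b \<in> Basis" "\<bar>y \<bullet> b\<bar> > R"
        by (auto simp: C_def mem_box abs_le_iff not_le)
      then have "R \<le> norm y" using Basis_le_norm[OF b(1), of y] by simp
      then have "exp (norm y) \<le> exp (- R) * exp (2 * norm y)"
        by (simp add: exp_add[symmetric])
      then have "2 * L * ?p y * exp (norm y) \<le> 2 * L * ?p y * (exp (- R) * exp (2 * norm y))"
        using L(1) pos(1)[of y] by (intro mult_left_mono) auto
      then have "kl_bound_integrand \<sigma> P n y \<le> (2 * L * exp (- R)) * (?p y * exp (2 * norm y))"
        using kl_bound_integrand_le_smooth_pdf[OF \<sigma> n L(1) L(2), of y] by (simp add: ac_simps)
      then have "ennreal (kl_bound_integrand \<sigma> P n y)
          \<le> ennreal (2 * L * exp (- R)) * ennreal (?p y * exp (2 * norm y))"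
        using L(1) pos(1)[of y] by (simp add: ennreal_mult[symmetric] ennreal_leI)
      with False show ?thesis by simp
    qed
    have "(\<integral>\<^sup>+y. ennreal (kl_bound_integrand \<sigma> P n y) \<partial>lborel)
        \<le> (\<integral>\<^sup>+y. ennreal (?c / n) * indicator C y
              + ennreal (2 * L * exp (- R)) * ennreal (?p y * exp (2 * norm y)) \<partial>lborel)"
      by (intro nn_integral_mono le)
    also have "\<dots> = ennreal (?c / n) * emeasure lborel C + ennreal (2 * L * exp (- R)) * ennreal I"
      by (simp add: nn_integral_add nn_integral_cmult nn_integral_cmult_indicator I)
    also have "\<dots> = ennreal (?c / n * (2 * R) ^ DIM('a) + (2 * L * I) * exp (- R))"
      unfolding C_def emeasure_lborel_centred_cube[OF R]
      using pos(2) L(1) I0 R n by (simp add: ennreal_mult[symmetric] ennreal_plus[symmetric] mult.commute mult.left_commute del: ennreal_plus)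
    finally show "(\<integral>\<^sup>+y. ennreal (kl_bound_integrand \<sigma> P n y) \<partial>lborel)
        \<le> ennreal (?c / n * (2 * R) ^ DIM('a) + (2 * L * I) * exp (- R))" .
  qed
qed

section \<open>The expected relative entropy\<close>

lemma
  fixes P :: "'a::ordered_euclidean_space measure" and X :: "nat \<Rightarrow> 'w \<Rightarrow> 'a"
  assumes P: "prob_space P" "sets P = sets borel" and \<sigma>: "\<sigma> > 0" and n: "n \<ge> 1"
    and \<Omega>: "prob_space \<Omega>" and indep: "prob_space.indep_vars \<Omega> (\<lambda>_. borel) X UNIV"
    and distr: "\<And>i. distr \<Omega> borel (X i) = P"
  shows integrable_pointwise_kl: "integrable \<Omega> (\<lambda>\<omega>. smooth_pdf \<sigma> (empirical_measure n (\<lambda>i. X i \<omega>)) y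
        * ln (smooth_pdf \<sigma> (empirical_measure n (\<lambda>i. X i \<omega>)) y / smooth_pdf \<sigma> P y))"
    and expectation_pointwise_kl_le: "(\<integral>\<omega>. smooth_pdf \<sigma> (empirical_measure n (\<lambda>i. X i \<omega>)) y
        * ln (smooth_pdf \<sigma> (empirical_measure n (\<lambda>i. X i \<omega>)) y / smooth_pdf \<sigma> P y) \<partial>\<Omega>)
      \<le> kl_bound_integrand \<sigma> P n y"
    and integrable_smooth_pdf_empirical_measure:
      "integrable \<Omega> (\<lambda>\<omega>. smooth_pdf \<sigma> (empirical_measure n (\<lambda>i. X i \<omega>)) y)"
    and expectation_smooth_pdf_empirical_measure:
      "(\<integral>\<omega>. smooth_pdf \<sigma> (empirical_measure n (\<lambda>i. X i \<omega>)) y \<partial>\<Omega>) = smooth_pdf \<sigma> P y"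
proof -
  interpret P: borel_prob P by (simp add: borel_prob_def borel_prob_axioms_def P)
  interpret \<Omega>: prob_space \<Omega> by fact
  have X [measurable]: "X i \<in> borel_measurable \<Omega>" for i
    using indep by (auto simp: \<Omega>.indep_vars_def)
  define Z where "Z = (\<lambda>i \<omega>. gauss_pdf \<sigma> (y - X i \<omega>))"
  define D where "D = distr P borel (\<lambda>x. gauss_pdf \<sigma> (y - x))"
  have Z: "smooth_pdf \<sigma> (empirical_measure n (\<lambda>i. X i \<omega>)) y = (\<Sum>i<n. Z i \<omega>) / n" for \<omega>
    by (simp add: smooth_pdf_empirical_measure[OF n] Z_def)
  have "\<Omega>.indep_vars (\<lambda>_. borel) X {..<n}"
    by (rule \<Omega>.indep_vars_subset[OF indep]) simp
  then have indep_Z: "\<Omega>.indep_vars (\<lambda>_. borel) Z {..<n}"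
    unfolding Z_def by (rule \<Omega>.indep_vars_compose2) measurable
  have distr_Z: "distr \<Omega> borel (Z i) = D" for i
    unfolding D_def Z_def distr[of i, symmetric] by (subst distr_distr) (auto simp: comp_def)
  have pos: "0 < Z i \<omega>" and le: "Z i \<omega> \<le> gauss_pdf \<sigma> (0::'a)" for i \<omega>
    using gauss_pdf_pos[OF \<sigma>] gauss_pdf_le_peak[OF \<sigma>] by (auto simp: Z_def)
  have D: "(\<integral>z. f z \<partial>D) = (\<integral>x. f (gauss_pdf \<sigma> (y - x)) \<partial>P)" if "f \<in> borel_measurable borel"
    for f :: "real \<Rightarrow> real"
    unfolding D_def using that by (subst integral_distr) auto
  have m: "smooth_pdf \<sigma> P y = (\<integral>z. z \<partial>D)"
    by (subst D) (auto simp: smooth_pdf_def)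
  note facts = n indep_Z distr_Z pos le m P.smooth_pdf_pos[OF \<sigma>]
  show "integrable \<Omega> (\<lambda>\<omega>. smooth_pdf \<sigma> (empirical_measure n (\<lambda>i. X i \<omega>)) y
        * ln (smooth_pdf \<sigma> (empirical_measure n (\<lambda>i. X i \<omega>)) y / smooth_pdf \<sigma> P y))"
    unfolding Z by (rule \<Omega>.integrable_mean_ln_mean[OF facts])
  have "kl_bound_integrand \<sigma> P n y = (\<integral>z. z * ln (1 + z / (n * smooth_pdf \<sigma> P y)) \<partial>D)"
    unfolding kl_bound_integrand_def by (subst D) auto
  then show "(\<integral>\<omega>. smooth_pdf \<sigma> (empirical_measure n (\<lambda>i. X i \<omega>)) y
        * ln (smooth_pdf \<sigma> (empirical_measure n (\<lambda>i. X i \<omega>)) y / smooth_pdf \<sigma> P y) \<partial>\<Omega>)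
      \<le> kl_bound_integrand \<sigma> P n y"
    unfolding Z using \<Omega>.expectation_mean_ln_mean_le[OF facts] by simp
  have int_Z: "integrable \<Omega> (Z i)" for i
  proof (rule \<Omega>.integrable_const_bound)
    show "AE \<omega> in \<Omega>. norm (Z i \<omega>) \<le> gauss_pdf \<sigma> (0::'a)"
      using pos le by (auto simp: abs_of_pos)
  qed (simp add: Z_def)
  show "integrable \<Omega> (\<lambda>\<omega>. smooth_pdf \<sigma> (empirical_measure n (\<lambda>i. X i \<omega>)) y)"
    unfolding Z by (intro integrable_divide Bochner_Integration.integrable_sum int_Z)
  have "(\<integral>\<omega>. Z i \<omega> \<partial>\<Omega>) = smooth_pdf \<sigma> P y" for i
    unfolding m distr_Z[of i, symmetric] by (subst integral_distr) (auto simp: Z_def)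
  then show "(\<integral>\<omega>. smooth_pdf \<sigma> (empirical_measure n (\<lambda>i. X i \<omega>)) y \<partial>\<Omega>) = smooth_pdf \<sigma> P y"
    unfolding Z integral_divide_zero using int_Z n
    by (subst Bochner_Integration.integral_sum) auto
qed

text \<open>
  The integrand of the divergence changes sign. Subtracting the first density and adding the second
  one makes it nonnegative without changing its integral over \<open>y\<close>, since both densities integrate to one, nor
  its expectation, since the empirical density has the other one as its mean. Tonelli's theorem
  then applies, and it also yields the measurability of the divergence in the sample.
\<close>

lemma nn_integral_D_KL_empirical_le:
  fixes P :: "'a::ordered_euclidean_space measure" and X :: "nat \<Rightarrow> 'w \<Rightarrow> 'a"
  assumes P: "prob_space P" "sets P = sets borel" and \<sigma>: "\<sigma> > 0" and n: "n \<ge> 1"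
    and \<Omega>: "prob_space \<Omega>" and indep: "prob_space.indep_vars \<Omega> (\<lambda>_. borel) X UNIV"
    and distr: "\<And>i. distr \<Omega> borel (X i) = P"
  defines "D \<equiv> \<lambda>\<omega>. D_KL (empirical_measure n (\<lambda>i. X i \<omega>) \<star> gaussian \<sigma>) (P \<star> gaussian \<sigma>)"
  shows "\<And>\<omega>. 0 \<le> D \<omega>"
    and "D \<in> borel_measurable \<Omega>"
    and "(\<integral>\<^sup>+\<omega>. ennreal (D \<omega>) \<partial>\<Omega>) \<le> (\<integral>\<^sup>+y. ennreal (kl_bound_integrand \<sigma> P n y) \<partial>lborel)"
proof -
  interpret P: borel_prob P by (simp add: borel_prob_def borel_prob_axioms_def P)
  interpret \<Omega>: prob_space \<Omega> by fact
  interpret L: pair_sigma_finite \<Omega> "lborel :: 'a measure" ..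
  have X [measurable]: "X i \<in> borel_measurable \<Omega>" for i
    using indep by (auto simp: \<Omega>.indep_vars_def)
  let ?E = "\<lambda>\<omega>. empirical_measure n (\<lambda>i. X i \<omega>)"
  let ?p = "smooth_pdf \<sigma> P" and ?q = "\<lambda>\<omega>. smooth_pdf \<sigma> (?E \<omega>)"
  have E: "prob_space (?E \<omega>)" "sets (?E \<omega>) = sets borel" for \<omega>
    using prob_space_empirical_measure[OF n] by auto
  have q_pos: "?q \<omega> y > 0" for \<omega> y
  proof -
    interpret borel_prob "?E \<omega>" by (simp add: borel_prob_def borel_prob_axioms_def E)
    show ?thesis by (rule smooth_pdf_pos[OF \<sigma>])
  qed
  define h where "h = (\<lambda>\<omega> y. ?q \<omega> y * ln (?q \<omega> y / ?p y) - ?q \<omega> y + ?p y)"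
  have h_nonneg: "h \<omega> y \<ge> 0" for \<omega> y
    unfolding h_def by (rule mult_ln_divide_minus_nonneg[OF q_pos P.smooth_pdf_pos[OF \<sigma>]])
  have h_meas [measurable]: "(\<lambda>(\<omega>, y). h \<omega> y) \<in> borel_measurable (\<Omega> \<Otimes>\<^sub>M lborel)"
    unfolding h_def smooth_pdf_empirical_measure[OF n] by measurable
  have D: "D \<omega> \<ge> 0" "ennreal (D \<omega>) = (\<integral>\<^sup>+y. ennreal (h \<omega> y) \<partial>lborel)" for \<omega>
  proof -
    note int = integrable_smooth_pdf_mult_ln[OF E P \<sigma> empirical_measure_exp_norm_finite[OF n], of \<omega>]
      integrable_smooth_pdf[OF E \<sigma>, of \<omega>] integrable_smooth_pdf[OF P \<sigma>]
    have int_diff: "integrable lborel (\<lambda>y. ?q \<omega> y * ln (?q \<omega> y / ?p y) - ?q \<omega> y)"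
      by (intro Bochner_Integration.integrable_diff int)
    have int_h: "integrable lborel (h \<omega>)"
      unfolding h_def by (intro Bochner_Integration.integrable_add int_diff int)
    have "(\<integral>y. h \<omega> y \<partial>lborel)
        = (\<integral>y. ?q \<omega> y * ln (?q \<omega> y / ?p y) \<partial>lborel) - (\<integral>y. ?q \<omega> y \<partial>lborel) + (\<integral>y. ?p y \<partial>lborel)"
      unfolding h_def
      by (simp only: Bochner_Integration.integral_add[OF int_diff int(3)]
          Bochner_Integration.integral_diff[OF int(1,2)])
    also have "\<dots> = D \<omega>"
      unfolding D_def
        D_KL_convolution_gaussian[OF E P \<sigma> empirical_measure_exp_norm_finite[OF n]]
      by (simp add: integral_smooth_pdf[OF E \<sigma>] integral_smooth_pdf[OF P \<sigma>])
    finally have eq: "(\<integral>y. h \<omega> y \<partial>lborel) = D \<omega>" .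
    show "D \<omega> \<ge> 0" unfolding eq[symmetric] using h_nonneg by simp
    show "ennreal (D \<omega>) = (\<integral>\<^sup>+y. ennreal (h \<omega> y) \<partial>lborel)"
      unfolding eq[symmetric] using h_nonneg
      by (intro nn_integral_eq_integral[symmetric] int_h) auto
  qed
  show "0 \<le> D \<omega>" for \<omega> by (rule D)
  have "D = (\<lambda>\<omega>. enn2real (\<integral>\<^sup>+y. ennreal (h \<omega> y) \<partial>lborel))"
    unfolding D(2)[symmetric] using D(1) by simp
  moreover have "(\<lambda>\<omega>. enn2real (\<integral>\<^sup>+y. ennreal (h \<omega> y) \<partial>lborel)) \<in> borel_measurable \<Omega>"
    by measurable
  ultimately show "D \<in> borel_measurable \<Omega>" by simp
  have "(\<integral>\<^sup>+\<omega>. ennreal (D \<omega>) \<partial>\<Omega>) = (\<integral>\<^sup>+\<omega>. \<integral>\<^sup>+y. ennreal (h \<omega> y) \<partial>lborel \<partial>\<Omega>)"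
    by (simp add: D)
  also have "\<dots> = (\<integral>\<^sup>+y. \<integral>\<^sup>+\<omega>. ennreal (h \<omega> y) \<partial>\<Omega> \<partial>lborel)"
    by (rule L.Fubini'[symmetric]) measurable
  also have "\<dots> \<le> (\<integral>\<^sup>+y. ennreal (kl_bound_integrand \<sigma> P n y) \<partial>lborel)"
  proof (rule nn_integral_mono)
    fix y :: 'a
    note assms' = P \<sigma> n \<Omega> indep distr
    note int = integrable_pointwise_kl[OF assms', of y]
      integrable_smooth_pdf_empirical_measure[OF assms', of y]
    have int_diff: "integrable \<Omega> (\<lambda>\<omega>. ?q \<omega> y * ln (?q \<omega> y / ?p y) - ?q \<omega> y)"
      by (intro Bochner_Integration.integrable_diff int)
    have int_p: "integrable \<Omega> (\<lambda>\<omega>. ?p y)" by simp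
    have "(\<integral>\<omega>. h \<omega> y \<partial>\<Omega>)
        = (\<integral>\<omega>. ?q \<omega> y * ln (?q \<omega> y / ?p y) \<partial>\<Omega>) - (\<integral>\<omega>. ?q \<omega> y \<partial>\<Omega>) + (\<integral>\<omega>. ?p y \<partial>\<Omega>)"
      unfolding h_def
      by (simp only: Bochner_Integration.integral_add[OF int_diff int_p]
          Bochner_Integration.integral_diff[OF int])
    also have "\<dots> \<le> kl_bound_integrand \<sigma> P n y"
      using expectation_pointwise_kl_le[OF assms', of y] \<Omega>.prob_space
      by (simp add: expectation_smooth_pdf_empirical_measure[OF assms'])
    finally have "ennreal (\<integral>\<omega>. h \<omega> y \<partial>\<Omega>) \<le> ennreal (kl_bound_integrand \<sigma> P n y)"
      by (rule ennreal_leI)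
    moreover have "integrable \<Omega> (\<lambda>\<omega>. h \<omega> y)"
      unfolding h_def by (intro Bochner_Integration.integrable_add int_diff int_p)
    then have "(\<integral>\<^sup>+\<omega>. ennreal (h \<omega> y) \<partial>\<Omega>) = ennreal (\<integral>\<omega>. h \<omega> y \<partial>\<Omega>)"
      using h_nonneg by (intro nn_integral_eq_integral) auto
    ultimately show "(\<integral>\<^sup>+\<omega>. ennreal (h \<omega> y) \<partial>\<Omega>) \<le> ennreal (kl_bound_integrand \<sigma> P n y)"
      by simp
  qed
  finally show "(\<integral>\<^sup>+\<omega>. ennreal (D \<omega>) \<partial>\<Omega>) \<le> (\<integral>\<^sup>+y. ennreal (kl_bound_integrand \<sigma> P n y) \<partial>lborel)" .
qed

theorem theorem3:
  fixes P :: "(real ^ 'd) measure"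
    and \<Omega> :: "'w measure"
    and X :: "nat \<Rightarrow> 'w \<Rightarrow> real ^ 'd"
    and K \<sigma> :: real
  assumes "K > 0" and "\<sigma> > 0"
    and "prob_space P" and "sets P = sets borel" and "subgaussian K P"
    and "prob_space \<Omega>"
    and "prob_space.indep_vars \<Omega> (\<lambda>_. borel) X UNIV"
    and "\<And>i. distr \<Omega> borel (X i) = P"
  shows "(\<forall>n\<ge>1.
            (AE \<omega> in \<Omega>. finite_D_KL
               (empirical_measure n (\<lambda>i. X i \<omega>) \<star> gaussian \<sigma>) (P \<star> gaussian \<sigma>)) \<and>
            integrable \<Omega> (\<lambda>\<omega>. D_KL
               (empirical_measure n (\<lambda>i. X i \<omega>) \<star> gaussian \<sigma>) (P \<star> gaussian \<sigma>))) \<and>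
         (\<lambda>n. \<integral>\<omega>. D_KL
               (empirical_measure n (\<lambda>i. X i \<omega>) \<star> gaussian \<sigma>) (P \<star> gaussian \<sigma>) \<partial>\<Omega>)
           \<in> O(\<lambda>n. ln (real n) ^ CARD('d) / real n)"
proof -
  define D where "D = (\<lambda>n \<omega>. D_KL
      (empirical_measure n (\<lambda>i. X i \<omega>) \<star> gaussian \<sigma>) (P \<star> gaussian \<sigma>))"
  define c where "c = gauss_pdf \<sigma> (0 :: real ^ 'd)"
  note P = assms(3,4) and \<sigma> = assms(2)
  note exp_norm = subgaussian_exp_norm_finite[OF assms(4,5)]
  obtain B where B: "B \<ge> 0"
    and kl_le: "\<And>n R. n \<ge> 1 \<Longrightarrow> R \<ge> 0 \<Longrightarrow> (\<integral>\<^sup>+y. ennreal (kl_bound_integrand \<sigma> P n y) \<partial>lborel)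
      \<le> ennreal (c / n * (2 * R) ^ DIM(real ^ 'd) + B * exp (- R))"
    unfolding c_def using nn_integral_kl_bound_integrand_le[OF P \<sigma> exp_norm] by blast
  have c: "c > 0" unfolding c_def by (rule gauss_pdf_pos[OF \<sigma>])
  have D_meas: "D n \<in> borel_measurable \<Omega>" and D_nonneg: "\<And>\<omega>. 0 \<le> D n \<omega>"
    and D_le: "\<And>R. R \<ge> 0 \<Longrightarrow> (\<integral>\<^sup>+\<omega>. ennreal (D n \<omega>) \<partial>\<Omega>)
        \<le> ennreal (c / n * (2 * R) ^ DIM(real ^ 'd) + B * exp (- R))"
    if n: "n \<ge> 1" for n
    using nn_integral_D_KL_empirical_le[OF P \<sigma> n assms(6,7,8)] kl_le[OF n] order_trans
    unfolding D_def by blast+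
  have D_int: "integrable \<Omega> (D n)" if n: "n \<ge> 1" for n
    using D_meas[OF n] D_nonneg[OF n] le_less_trans[OF D_le[OF n order_refl]]
    by (intro integrableI_bounded) (auto simp: abs_of_nonneg)
  \<comment> \<open>The half side \<open>ln n\<close> makes the tail of order \<open>1 / n\<close>, while the cube has volume \<open>(2 * ln n) ^ CARD('d)\<close>.\<close>
  have E_D_le: "(\<integral>\<omega>. D n \<omega> \<partial>\<Omega>) \<le> c / n * (2 * ln n) ^ CARD('d) + B / n" if n: "n \<ge> 1" for n
  proof -
    have "ennreal (\<integral>\<omega>. D n \<omega> \<partial>\<Omega>) = (\<integral>\<^sup>+\<omega>. ennreal (D n \<omega>) \<partial>\<Omega>)"
      using D_nonneg[OF n] by (intro nn_integral_eq_integral[symmetric] D_int[OF n]) auto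
    also have "\<dots> \<le> ennreal (c / n * (2 * ln n) ^ CARD('d) + B / n)"
      using D_le[OF n, of "ln n"] n by (simp add: exp_minus divide_inverse)
    finally show ?thesis
      using n c B by (subst (asm) ennreal_le_iff) auto
  qed
  have "(\<lambda>n. \<integral>\<omega>. D n \<omega> \<partial>\<Omega>) \<in> O(\<lambda>n. ln (real n) ^ CARD('d) / real n)"
  proof (rule bigoI)
    show "\<forall>\<^sub>F n in sequentially. norm (\<integral>\<omega>. D n \<omega> \<partial>\<Omega>)
        \<le> (c * 2 ^ CARD('d) + B) * norm (ln (real n) ^ CARD('d) / real n)"
    proof (rule eventually_sequentiallyI)
      fix n :: nat assume n: "n \<ge> 3"
      \<comment> \<open>From \<open>n = 3\<close> on, \<open>ln n \<ge> 1\<close>, so the tail is dominated by the main term.\<close>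
      have "exp 1 \<le> real n" using exp_le n by linarith
      then have "ln (exp 1) \<le> ln (real n)" using n by (subst ln_le_cancel_iff) auto
      then have ln: "1 \<le> ln (real n)" by simp
      have "(\<integral>\<omega>. D n \<omega> \<partial>\<Omega>) \<le> c / n * (2 * ln n) ^ CARD('d) + B / n"
        using n by (intro E_D_le) simp
      also have "\<dots> \<le> c / n * (2 * ln n) ^ CARD('d) + B * ln n ^ CARD('d) / n"
        using B n mult_left_mono[OF one_le_power[OF ln] B]
        by (intro add_left_mono divide_right_mono) auto
      also have "\<dots> = (c * 2 ^ CARD('d) + B) * (ln (real n) ^ CARD('d) / real n)"
        by (simp add: power_mult_distrib add_divide_distrib distrib_right)
      finally show "norm (\<integral>\<omega>. D n \<omega> \<partial>\<Omega>)
          \<le> (c * 2 ^ CARD('d) + B) * norm (ln (real n) ^ CARD('d) / real n)"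
        using D_nonneg[of n] n ln by simp
    qed
  qed
  moreover have "finite_D_KL (empirical_measure n (\<lambda>i. X i \<omega>) \<star> gaussian \<sigma>) (P \<star> gaussian \<sigma>)"
    if n: "n \<ge> 1" for n \<omega>
    by (intro finite_D_KL_convolution_gaussian prob_space_empirical_measure
        empirical_measure_exp_norm_finite n P \<sigma>) simp
  ultimately show ?thesis
    using D_int unfolding D_def by simp
qed

end
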